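(* Let $Z \subset \mathbb{R}^n$ be a zonotope with non-empty interior and with at most $n+1$ generators. Then $$L_Z \leq L_{C_n},$$ with equality if and only if $Z$ is affinely equivalent to $C_n$, where $C_n = \sum_{i=1}^n[-e_i,e_i]\subset\mathbb{R}^n$.
   Context: For a compact convex set $K\subset\mathbb{R}^n$ with non-empty interior, the covariance matrix is $A_K = \mathbb{E}[XX^{\mathsf T}] - \mathbb{E}[X]\mathbb{E}[X]^{\mathsf T}$, where $X$ is uniformly distributed on $K$, and the isotropic constant $L_K>0$ is defined by $L_K^{2n} = \det A_K/(\mathrm{vol}\, K)^2$ (an affine invariant). A zonotope with at most $n+1$ generators is a set of the form $Z=c+\sum_{i=1}^m[-z_i,z_i]$ (Minkowski sum) with $c,z_1,\dots,z_m\in\mathbb{R}^n$ and $m\le n+1$. Here $e_1,\dots,e_n$ is the standard basis, so $C_n=[-1,1]^n$. *)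

theory Defs
  imports "HOL-Analysis.Analysis"
begin

definition covariance_matrix :: "(real ^ 'n) set \<Rightarrow> real ^ 'n ^ 'n" where
  "covariance_matrix K = (\<chi> i j.
     (\<integral>x. x $ i * x $ j \<partial>uniform_measure lborel K) -
     (\<integral>x. x $ i \<partial>uniform_measure lborel K) * (\<integral>x. x $ j \<partial>uniform_measure lborel K))"

(* Intended for compact convex K with non-empty interior; there the radicand is positive,
   so this is the unique positive L with L ^ (2 * CARD('n)) = det A_K / (vol K)^2. *)
definition isotropic_constant :: "(real ^ 'n) set \<Rightarrow> real" where
  "isotropic_constant K =
     root (2 * CARD('n)) (det (covariance_matrix K) / (measure lborel K)\<^sup>2)"

(* The operations + and \<Sum> on sets are Minkowski addition (HOL-Library.Set_Algebras),
   here and in standard_cube. The generators z i may vanish or be parallel. *)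
definition zonotope_with_generators :: "nat \<Rightarrow> (real ^ 'n) set \<Rightarrow> bool" where
  "zonotope_with_generators m Z \<longleftrightarrow>
     (\<exists>(c :: real ^ 'n) (z :: nat \<Rightarrow> real ^ 'n).
        Z = {c} + (\<Sum>i<m. closed_segment (- z i) (z i)))"

definition standard_cube :: "(real ^ 'n) set" where
  "standard_cube = (\<Sum>i\<in>UNIV. closed_segment (- axis i 1) (axis i 1))"

definition affinely_equivalent :: "(real ^ 'n) set \<Rightarrow> (real ^ 'n) set \<Rightarrow> bool" where
  "affinely_equivalent S T \<longleftrightarrow>
     (\<exists>(A :: real ^ 'n ^ 'n) b. invertible A \<and> T = (\<lambda>x. A *v x + b) ` S)"

end

theory Submission
  imports Defs
begin

text \<open>
  Let \<open>C\<close> be the cube \<open>[-1,1]^n\<close>. Both sides of the inequality are affine invariants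
  (\<open>isotropic_constant_affine_image\<close>). A zonotope with interior has \<open>n\<close> linearly independent
  generators, so after an affine change of coordinates and a choice of signs it is
  \<open>C + [-w, w]\<close> with \<open>w \<ge> 0\<close>; the vector \<open>w\<close> carries the one generator that may be left over
  (\<open>zonotope_normal_form\<close>).

  The body \<open>C + [-w, w]\<close> consists of the translate \<open>C - w\<close> and, for each coordinate \<open>i\<close>, the prism
  swept out by the facet \<open>x_i = 1\<close> of \<open>C\<close> when it moves along \<open>[-w, w]\<close>. All these pieces are affine
  images of \<open>C\<close> and overlap in null sets, so the moments of \<open>C + [-w, w]\<close> follow from those of \<open>C\<close>
  (\<open>cube_plus_segment_moments\<close>). With \<open>S = 1 + \<Sum>w_i\<close> the volume is \<open>2^n S\<close>, the centroid is \<open>0\<close>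
  and the covariance matrix is
  \<open>(1/3) (I + (2/S) diag w + (1 + 2/S) w w^T)\<close>, whose determinant is explicit because the last term
  has rank one (\<open>det_diagonal_plus_outer\<close>).

  It remains to maximise \<open>det_ratio w\<close>, the quotient of \<open>det A_Z / vol(Z)^2\<close> by its value at
  \<open>w = 0\<close>. In the barycentric coordinates \<open>p_0 = 1/S\<close>, \<open>p_i = w_i/S\<close>, which are nonnegative with
  sum \<open>1\<close>, this quotient is symmetric: it equals
  \<open>\<Sum>_i p_i^2 \<Prod>_{j \<noteq> i} (1 + 2 p_j) = 1 - \<Sum>_{k \<ge> 3} (k - 2) 2^(k-2) e_k(p)\<close>, where \<open>e_k\<close> is the
  \<open>k\<close>-th elementary symmetric polynomial. Hence it is at most \<open>1\<close>, with equality iff at most two of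
  the \<open>p_i\<close> are nonzero. As \<open>p_0 > 0\<close>, this says that at most one \<open>w_i\<close> is nonzero, and then
  \<open>C + [-w, w]\<close> is a cube stretched in one coordinate. The proof below avoids symmetric polynomials:
  \<open>prod_defect_le\<close> establishes what is needed by adjoining one variable at a time.
\<close>

section \<open>Lebesgue measure under affine maps\<close>

text \<open>
  Every linear map is a composition of singular maps, coordinate scalings, coordinate swaps and shears.
  Singular maps have null images and scalings are immediate. Swaps and shears have determinant
  \<open>\<plusminus>1\<close>, and for them it suffices to see that boxes keep their volume.
\<close>

lemma measure_linear_image_det:
  fixes f :: "real^'n \<Rightarrow> real^'n"
  assumes "linear f" "S \<in> lmeasurable"
  shows "f ` S \<in> lmeasurable \<and> measure lebesgue (f ` S) = \<bar>det (matrix f)\<bar> * measure lebesgue S"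
  using assms(2)
proof (induction arbitrary: S rule: induct_linear_elementary[OF \<open>linear f\<close>])
  case (1 f g)
  have "(f \<circ> g) ` S = f ` (g ` S)"
    by (simp add: image_comp)
  then show ?case
    using 1(3)[OF 1(4)[OF 1(5), THEN conjunct1]] 1(4)[OF 1(5)] 
    by (simp add: matrix_compose[OF 1(2,1), unfolded o_def] o_def abs_mult det_mul)
next
  case (2 f i)
  then have "\<not> inj f"
    by (metis (full_types) linear_injective_imp_surjective one_neq_zero surjE vec_component)
  then have "negligible (f ` S)" "det (matrix f) = 0"
    using 2 det_nz_iff_inj[of f] negligible_linear_singular_image by blast+
  then show ?case
    by (simp add: negligible_iff_measure)
next
  case (3 c)
  then show ?case
    using measurable_stretch[of S c] measure_stretch[of S c]
    by (simp add: axis_def matrix_def det_diagonal)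
next
  case (4 m n)
  let ?h = "\<lambda>x::real^'n. \<chi> i. x $ Transposition.transpose m n i"
  have lin: "linear ?h"
    by (rule linearI) (simp_all add: vec_eq_iff)
  have image: "?h ` cbox a b = cbox (?h a) (?h b)" for a b
    by (auto simp: image_iff lambda_swap_Galois mem_box_cart) (metis transpose_involutory)+
  have vol: "measure lebesgue (?h ` cbox a b) = 1 * measure lebesgue (cbox a b)" for a b
  proof (cases "cbox a b = {}")
    case False
    then have "cbox (?h a) (?h b) \<noteq> {}"
      using image by blast
    moreover have "(\<Prod>i\<in>UNIV. ?h b $ i - ?h a $ i) = (\<Prod>i\<in>UNIV. b $ i - a $ i)"
      using prod.permute[OF permutes_swap_id[of m UNIV n], of "\<lambda>i. (b - a) $ i"]
      by simp
    ultimately show ?thesis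
      using False by (simp add: image content_cbox_cart)
  qed simp
  have "matrix ?h = (\<chi> i. mat 1 $ Transposition.transpose m n i)"
    by (auto simp: matrix_def axis_def mat_def vec_eq_iff)
  then have "\<bar>det (matrix ?h)\<bar> = 1"
    by (simp add: det_permute_rows permutes_swap_id sign_swap_id abs_mult)
  then show ?case
    using measure_linear_sufficient[OF lin 4(2) vol] by simp
next
  case (5 m n)
  let ?h = "\<lambda>x::real^'n. \<chi> i. if i = m then x $ m + x $ n else x $ i"
  have lin: "linear ?h"
    by (rule linearI) (auto simp: vec_eq_iff algebra_simps)
  have vol: "measure lebesgue (?h ` cbox a b) = 1 * measure lebesgue (cbox a b)" for a b
  proof (cases "cbox a b = {}")
    case False
    \<comment> \<open>Translating along coordinate \<^term>\<open>n\<close> reduces to a box with nonnegative \<^term>\<open>n\<close>-coordinates.\<close>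
    define v where "v = axis n (a $ n)"
    have "cbox a b = (+) v ` cbox (a - v) (b - v)"
      by (simp add: cbox_translation[symmetric])
    then have "?h ` cbox a b = (+) (?h v) ` (?h ` cbox (a - v) (b - v))"
      using linear_add[OF lin] by (simp add: image_image)
    then have "measure lebesgue (?h ` cbox a b) = measure lebesgue (?h ` cbox (a - v) (b - v))"
      by (simp add: measure_translation)
    also have "\<dots> = measure lebesgue (cbox (a - v) (b - v))"
    proof (rule measure_shear_interval[OF 5(1)])
      show "cbox (a - v) (b - v) \<noteq> {}"
        using False \<open>cbox a b = _\<close> by (metis image_empty)
      show "0 \<le> (a - v) $ n"
        by (simp add: v_def)
    qed
    also have "\<dots> = measure lebesgue (cbox a b)"
      by (simp only: \<open>cbox a b = _\<close> measure_translation)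
    finally show ?thesis by simp
  qed simp
  have "matrix ?h = (\<chi> k. if k = m then row m (mat 1) + 1 *s row n (mat 1) else row k (mat 1))"
    by (auto simp: matrix_def axis_def mat_def row_def vec_eq_iff)
  then have "det (matrix ?h) = 1"
    using det_row_operation[OF 5(1), of "mat 1" 1] by simp
  then show ?case
    using measure_linear_sufficient[OF lin 5(2) vol] by simp
qed

text \<open>
  The preimage of a box is its image under the inverse matrix, which has the reciprocal determinant;
  hence both measures agree on boxes.
\<close>

lemma lborel_linear:
  fixes A :: "real^'n^'n"
  assumes "det A \<noteq> 0"
  shows "lborel = density (distr lborel borel ((*v) A)) (\<lambda>_. ennreal \<bar>det A\<bar>)"
proof (rule lborel_eqI)
  fix l u :: "real^'n"
  assume lu: "\<And>b. b \<in> Basis \<Longrightarrow> l \<bullet> b \<le> u \<bullet> b"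
  obtain B where B: "A ** B = mat 1" "B ** A = mat 1"
    using assms invertible_det_nz invertible_def by blast
  have AB: "A *v (B *v x) = x" "B *v (A *v x) = x" for x
    by (simp_all add: matrix_vector_mul_assoc B)
  have detB: "\<bar>det A\<bar> * \<bar>det B\<bar> = 1"
    using B(1) det_mul[of A B] by (metis abs_mult abs_one det_I)
  have [measurable]: "(*v) A \<in> borel_measurable borel"
    by (intro borel_measurable_continuous_onI matrix_vector_mult_linear_continuous_on)
  have "(*v) A -` box l u = (*v) B ` box l u"
    using AB by (auto simp: image_iff) metis+
  moreover have "(*v) B ` box l u \<in> lmeasurable"
    and "measure lebesgue ((*v) B ` box l u) = \<bar>det B\<bar> * measure lebesgue (box l u)"
    using measure_linear_image_det[OF matrix_vector_mul_linear[of B], of "box l u"] by simp_all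
  moreover have "(*v) A -` box l u \<in> sets borel"
    using measurable_sets[of "(*v) A" borel borel "box l u"] by simp
  ultimately have "emeasure lebesgue ((*v) A -` box l u) = ennreal (\<bar>det B\<bar> * measure lborel (box l u))"
    by (simp add: emeasure_eq_measure2)
  then have "emeasure lborel ((*v) A -` box l u) = ennreal (\<bar>det B\<bar> * measure lborel (box l u))"
    using \<open>(*v) A -` box l u \<in> sets borel\<close> by (simp add: emeasure_completion)
  then have "emeasure (density (distr lborel borel ((*v) A)) (\<lambda>_. ennreal \<bar>det A\<bar>)) (box l u)
      = ennreal \<bar>det A\<bar> * ennreal (\<bar>det B\<bar> * measure lborel (box l u))"
    by (simp add: emeasure_density nn_integral_cmult_indicator emeasure_distr)
  also have "\<dots> = ennreal (measure lborel (box l u))"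
    using detB by (simp add: ennreal_mult'[symmetric] mult.assoc[symmetric])
  also have "\<dots> = (\<Prod>b\<in>Basis. (u - l) \<bullet> b)"
    using lu by (simp add: measure_lborel_box_eq)
  finally show "emeasure (density (distr lborel borel ((*v) A)) (\<lambda>_. ennreal \<bar>det A\<bar>)) (box l u)
      = (\<Prod>b\<in>Basis. (u - l) \<bullet> b)" .
qed simp

lemma lborel_integral_affine:
  fixes A :: "real^'n^'n" and g :: "real^'n \<Rightarrow> real"
  assumes "det A \<noteq> 0" and [measurable]: "g \<in> borel_measurable borel"
  shows "(LINT x|lborel. g x) = \<bar>det A\<bar> * (LINT x|lborel. g (A *v x + b))"
proof -
  have [measurable]: "(*v) A \<in> borel_measurable borel"
    by (intro borel_measurable_continuous_onI matrix_vector_mult_linear_continuous_on)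
  have "(LINT x|lborel. g x) = (LINT x|distr lborel borel ((+) b). g x)"
    by (simp add: lborel_distr_plus)
  also have "\<dots> = (LINT x|lborel. g (b + x))"
    by (subst integral_distr) auto
  also have "\<dots> = (LINT x|density (distr lborel borel ((*v) A)) (\<lambda>_. ennreal \<bar>det A\<bar>). g (b + x))"
    using lborel_linear[OF assms(1)] by simp
  also have "\<dots> = \<bar>det A\<bar> * (LINT x|lborel. g (b + A *v x))"
    by (subst integral_density) (auto simp: integral_distr)
  finally show ?thesis
    by (simp add: add.commute)
qed

lemma compact_affine_image:
  fixes A :: "real^'n^'n"
  assumes "compact K"
  shows "compact ((\<lambda>x. A *v x + b) ` K)"
  by (intro compact_continuous_image continuous_intros assms matrix_vector_mult_linear_continuous_on)

lemma integral_affine_image: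
  fixes A :: "real^'n^'n" and f :: "real^'n \<Rightarrow> real"
  assumes "det A \<noteq> 0" "compact K" and [measurable]: "f \<in> borel_measurable borel"
  shows "(LINT x:(\<lambda>x. A *v x + b) ` K|lborel. f x) = \<bar>det A\<bar> * (LINT x:K|lborel. f (A *v x + b))"
proof -
  let ?T = "\<lambda>x. A *v x + b"
  let ?g = "\<lambda>x. indicator (?T ` K) x *\<^sub>R f x"
  have [measurable]: "?T ` K \<in> sets borel"
    by (simp add: compact_affine_image assms(2) borel_compact)
  have "inj ?T"
    using inj_matrix_vector_mult[of A] assms(1) by (simp add: inj_def invertible_det_nz)
  then have "indicator (?T ` K) (?T x) = (indicator K x :: real)" for x
    by (simp only: indicator_def inj_image_mem_iff[OF \<open>inj ?T\<close>])
  moreover have "?g \<in> borel_measurable borel"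
    by measurable
  ultimately show ?thesis
    using lborel_integral_affine[OF assms(1), of ?g b] by (simp add: set_lebesgue_integral_def)
qed

section \<open>Moments and the isotropic constant under affine maps\<close>

lemma set_integrable_compact:
  fixes f :: "'a::euclidean_space \<Rightarrow> real"
  assumes "compact K" "continuous_on K f"
  shows "set_integrable lborel K f"
  using borel_integrable_compact[OF assms] by (simp add: set_integrable_def)

lemma set_integral_Union_negligible:
  fixes f :: "'a::euclidean_space \<Rightarrow> real"
  assumes "finite I" "\<And>i. i \<in> I \<Longrightarrow> compact (T i)" "continuous_on UNIV f"
    and "pairwise (\<lambda>i j. negligible (T i \<inter> T j)) I"
  shows "(LINT x:(\<Union>i\<in>I. T i)|lborel. f x) = (\<Sum>i\<in>I. LINT x:T i|lborel. f x)"
proof -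
  have cont: "continuous_on S f" for S
    using assms(3) continuous_on_subset by blast
  have "(f has_integral (LINT x:T i|lborel. f x)) (T i)" if "i \<in> I" for i
    using set_borel_integral_eq_integral[OF set_integrable_compact[OF assms(2)[OF that] cont]]
    by (simp add: has_integral_iff)
  then have "(f has_integral (\<Sum>i\<in>I. LINT x:T i|lborel. f x)) (\<Union>i\<in>I. T i)"
    using assms by (intro has_integral_UN) auto
  moreover have "compact (\<Union>i\<in>I. T i)"
    using assms by (intro compact_UN) auto
  ultimately show ?thesis
    using set_borel_integral_eq_integral[OF set_integrable_compact[OF _ cont]]
    by (simp add: has_integral_iff)
qed

lemma set_integral_lincomb:
  fixes g :: "'j \<Rightarrow> 'a::euclidean_space \<Rightarrow> real"
  assumes "compact K" "\<And>j. continuous_on UNIV (g j)"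
  shows "(LINT x:K|lborel. (\<Sum>j\<in>J. c j * g j x)) = (\<Sum>j\<in>J. c j * (LINT x:K|lborel. g j x))"
proof -
  have "integrable lborel (\<lambda>x. indicator K x *\<^sub>R g j x)" for j
    using set_integrable_compact[OF assms(1) continuous_on_subset[OF assms(2)]]
    by (simp add: set_integrable_def)
  then show ?thesis
    by (simp add: set_lebesgue_integral_def sum_distrib_left mult.left_commute)
qed

text \<open>
  The moments are not normalised by the volume, which makes them additive over tilings.
\<close>

definition first_moment :: "(real^'n) set \<Rightarrow> real^'n" where
  "first_moment K = (\<chi> i. LINT x:K|lborel. x $ i)"

definition second_moment :: "(real^'n) set \<Rightarrow> real^'n^'n" where
  "second_moment K = (\<chi> i j. LINT x:K|lborel. x $ i * x $ j)"

definition outer :: "real^'n \<Rightarrow> real^'n \<Rightarrow> real^'n^'n" where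
  "outer u v = (\<chi> i j. u $ i * v $ j)"

lemma outer_nth [simp]: "outer u v $ i $ j = u $ i * v $ j"
  by (simp add: outer_def)

lemma outer_add:
  "outer (u + u') v = outer u v + outer u' v" "outer u (v + v') = outer u v + outer u v'"
  by (simp_all add: vec_eq_iff algebra_simps)

lemma outer_scaleR:
  "outer (c *\<^sub>R u) v = c *\<^sub>R outer u v" "outer u (c *\<^sub>R v) = c *\<^sub>R outer u v"
  by (simp_all add: vec_eq_iff algebra_simps)

lemma matrix_mult_outer: "A ** outer u v = outer (A *v u) v"
  by (simp add: vec_eq_iff matrix_matrix_mult_def matrix_vector_mult_def sum_distrib_right mult.assoc)

lemma outer_mult_transpose: "outer u v ** transpose A = outer u (A *v v)"
  by (simp add: vec_eq_iff matrix_matrix_mult_def matrix_vector_mult_def transpose_def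
      sum_distrib_left mult_ac)

lemma congruence_linear:
  fixes A :: "real^'n^'n"
  shows "A ** (c *\<^sub>R M - N) ** transpose A = c *\<^sub>R (A ** M ** transpose A) - A ** N ** transpose A"
  by (simp add: vec_eq_iff matrix_matrix_mult_def algebra_simps sum_subtractf sum_distrib_left sum_distrib_right)

lemma measure_eq_set_integral: "measure lborel K = (LINT x:K|lborel. 1)" if "compact K" for K :: "(real^'n) set"
  using that by (simp add: set_lebesgue_integral_def borel_compact)

context
  fixes A :: "real^'n^'n" and b :: "real^'n" and K :: "(real^'n) set"
  assumes A: "det A \<noteq> 0" and K: "compact K"
begin

lemma measure_affine_image: "measure lborel ((\<lambda>x. A *v x + b) ` K) = \<bar>det A\<bar> * measure lborel K"
  using integral_affine_image[OF A K, of "\<lambda>_. 1" b]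
  by (simp add: measure_eq_set_integral K compact_affine_image)

lemma first_moment_affine_image:
  "first_moment ((\<lambda>x. A *v x + b) ` K) =
    \<bar>det A\<bar> *\<^sub>R (A *v first_moment K + measure lborel K *\<^sub>R b)"
proof -
  have "(LINT x:K|lborel. (A *v x + b) $ i) = (A *v first_moment K + measure lborel K *\<^sub>R b) $ i" for i
  proof -
    have "(LINT x:K|lborel. (A *v x + b) $ i) = (LINT x:K|lborel. (A *v x) $ i) + (LINT x:K|lborel. b $ i)"
      unfolding plus_vec_def vec_lambda_beta
      by (intro set_integral_add(2) set_integrable_compact K continuous_intros
          matrix_vector_mult_linear_continuous_on)
    also have "(LINT x:K|lborel. (A *v x) $ i) = (A *v first_moment K) $ i"
      by (simp add: matrix_vector_mult_def first_moment_def set_integral_lincomb[OF K] continuous_intros)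
    also have "(LINT x:K|lborel. b $ i) = measure lborel K * b $ i"
      using K by (simp add: set_lebesgue_integral_def borel_compact)
    finally show ?thesis by simp
  qed
  then show ?thesis
    by (simp add: first_moment_def vec_eq_iff integral_affine_image[OF A K])
qed

lemma second_moment_affine_image:
  "second_moment ((\<lambda>x. A *v x + b) ` K) =
    \<bar>det A\<bar> *\<^sub>R (A ** second_moment K ** transpose A + outer (A *v first_moment K) b
      + outer b (A *v first_moment K) + measure lborel K *\<^sub>R outer b b)"
proof -
  have I: "set_integrable lborel K (\<lambda>x. (A *v x) $ i * (A *v x) $ j)"
    "set_integrable lborel K (\<lambda>x. (A *v x) $ i * c)" "set_integrable lborel K (\<lambda>x. c * (A *v x) $ i)"
    "set_integrable lborel K (\<lambda>x. c)" for i j c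
    by (intro set_integrable_compact K continuous_intros matrix_vector_mult_linear_continuous_on)+
  have lin: "(LINT x:K|lborel. (A *v x) $ i) = (A *v first_moment K) $ i" for i
    by (simp add: matrix_vector_mult_def first_moment_def set_integral_lincomb[OF K] continuous_intros)
  have quad: "(LINT x:K|lborel. (A *v x) $ i * (A *v x) $ j)
      = (A ** second_moment K ** transpose A) $ i $ j" for i j
  proof -
    have "(A *v x) $ i * (A *v x) $ j
        = (\<Sum>l\<in>UNIV. A $ j $ l * (\<Sum>k\<in>UNIV. A $ i $ k * (x $ k * x $ l)))" for x
      by (simp add: matrix_vector_mult_def sum_distrib_left sum_distrib_right mult_ac)
    then show ?thesis
      by (simp add: matrix_matrix_mult_def transpose_def second_moment_def
          set_integral_lincomb[OF K] continuous_intros mult.commute)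
  qed
  have "(LINT x:K|lborel. (A *v x + b) $ i * (A *v x + b) $ j) =
      (A ** second_moment K ** transpose A + outer (A *v first_moment K) b
      + outer b (A *v first_moment K) + measure lborel K *\<^sub>R outer b b) $ i $ j" for i j
  proof -
    have "(LINT x:K|lborel. (A *v x + b) $ i * (A *v x + b) $ j) =
        (LINT x:K|lborel. (A *v x) $ i * (A *v x) $ j + (A *v x) $ i * b $ j
          + b $ i * (A *v x) $ j + b $ i * b $ j)"
      by (simp add: algebra_simps)
    also have "\<dots> = (LINT x:K|lborel. (A *v x) $ i * (A *v x) $ j) + (LINT x:K|lborel. (A *v x) $ i * b $ j)
        + (LINT x:K|lborel. b $ i * (A *v x) $ j) + (LINT x:K|lborel. b $ i * b $ j)"
      by (simp add: set_integral_add I)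
    also have "(LINT x:K|lborel. b $ i * b $ j) = measure lborel K * (b $ i * b $ j)"
      using K by (simp add: set_lebesgue_integral_def borel_compact)
    finally show ?thesis
      by (simp add: quad lin)
  qed
  then show ?thesis
    by (simp add: second_moment_def vec_eq_iff integral_affine_image[OF A K])
qed

end

lemma covariance_matrix_eq_moments:
  fixes K :: "(real^'n) set"
  assumes K: "compact K" and V: "measure lborel K > 0"
  shows "covariance_matrix K = (1 / measure lborel K) *\<^sub>R second_moment K
    - outer ((1 / measure lborel K) *\<^sub>R first_moment K) ((1 / measure lborel K) *\<^sub>R first_moment K)"
proof -
  have "emeasure lborel K = ennreal (measure lborel K)"
    using emeasure_compact_finite[OF K] by (simp add: emeasure_eq_ennreal_measure)
  then have "uniform_measure lborel K = density lborel (\<lambda>x. ennreal (indicator K x / measure lborel K))"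
    using V unfolding uniform_measure_def
    by (intro arg_cong[where f="density lborel"] ext)
       (auto simp: indicator_def divide_ennreal[symmetric] ennreal_1[symmetric] simp del: ennreal_1)
  moreover have [measurable]: "K \<in> sets borel"
    using K by (rule borel_compact)
  ultimately have "(\<integral>x. f x \<partial>uniform_measure lborel K) = (LINT x:K|lborel. f x) / measure lborel K"
    if [measurable]: "f \<in> borel_measurable borel" for f :: "real^'n \<Rightarrow> real"
    using V by (simp add: integral_density set_lebesgue_integral_def)
  then show ?thesis
    by (simp add: covariance_matrix_def first_moment_def second_moment_def vec_eq_iff)
qed

text \<open>
  The translation \<open>b\<close> cancels between the second moment and the square of the centroid.
\<close>

lemma covariance_matrix_affine_image:
  fixes A :: "real^'n^'n"
  assumes A: "det A \<noteq> 0" and K: "compact K" and V: "measure lborel K > 0"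
  shows "covariance_matrix ((\<lambda>x. A *v x + b) ` K) = A ** covariance_matrix K ** transpose A"
proof -
  let ?V = "measure lborel K" and ?m = "first_moment K" and ?M = "second_moment K"
  let ?W = "measure lborel ((\<lambda>x. A *v x + b) ` K)"
  have W: "?W = \<bar>det A\<bar> * ?V" "?W > 0"
    using A V by (simp_all add: measure_affine_image[OF A K])
  have "(1 / ?W) *\<^sub>R first_moment ((\<lambda>x. A *v x + b) ` K) = A *v ((1 / ?V) *\<^sub>R ?m) + b"
    using A V by (simp add: first_moment_affine_image[OF A K] W(1) matrix_vector_mult_scaleR scaleR_add_right)
  moreover have "(1 / ?W) *\<^sub>R second_moment ((\<lambda>x. A *v x + b) ` K)
      = (1 / ?V) *\<^sub>R (A ** ?M ** transpose A) + outer (A *v ((1 / ?V) *\<^sub>R ?m)) b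
      + outer b (A *v ((1 / ?V) *\<^sub>R ?m)) + outer b b"
    using A V by (simp add: second_moment_affine_image[OF A K] W(1) matrix_vector_mult_scaleR scaleR_add_right
        outer_scaleR)
  ultimately show ?thesis
    unfolding covariance_matrix_eq_moments[OF compact_affine_image[OF K] W(2)]
      covariance_matrix_eq_moments[OF K V] congruence_linear
      matrix_mult_outer outer_mult_transpose
    by (simp only: outer_add) (simp add: algebra_simps)
qed

text \<open>
  Both the determinant of the covariance matrix and the squared volume acquire the factor
  \<open>(det A)\<^sup>2\<close>.
\<close>

lemma isotropic_constant_affine_image:
  fixes A :: "real^'n^'n"
  assumes A: "det A \<noteq> 0" and K: "compact K" and V: "measure lborel K > 0"
  shows "isotropic_constant ((\<lambda>x. A *v x + b) ` K) = isotropic_constant K"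
proof -
  have "det (covariance_matrix ((\<lambda>x. A *v x + b) ` K)) = (det A)\<^sup>2 * det (covariance_matrix K)"
    by (simp add: covariance_matrix_affine_image[OF assms] det_mul power2_eq_square)
  moreover have "(measure lborel ((\<lambda>x. A *v x + b) ` K))\<^sup>2 = (det A)\<^sup>2 * (measure lborel K)\<^sup>2"
    by (simp add: measure_affine_image[OF A K] power_mult_distrib)
  ultimately show ?thesis
    using A by (simp add: isotropic_constant_def)
qed

section \<open>The cube\<close>

lemma mem_segment_symmetric:
  fixes z :: "'a::real_vector"
  shows "x \<in> closed_segment (- z) z \<longleftrightarrow> (\<exists>t. \<bar>t\<bar> \<le> 1 \<and> x = t *\<^sub>R z)"
proof
  assume "x \<in> closed_segment (- z) z"
  then obtain u where "0 \<le> u" "u \<le> 1" "x = (1 - u) *\<^sub>R (- z) + u *\<^sub>R z"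
    by (auto simp: closed_segment_def)
  then have "\<bar>2 * u - 1\<bar> \<le> 1" "x = (2 * u - 1) *\<^sub>R z"
    by (auto simp: algebra_simps scaleR_2 simp flip: scaleR_add_left)
  then show "\<exists>t. \<bar>t\<bar> \<le> 1 \<and> x = t *\<^sub>R z"
    by blast
next
  assume "\<exists>t. \<bar>t\<bar> \<le> 1 \<and> x = t *\<^sub>R z"
  then obtain t where t: "\<bar>t\<bar> \<le> 1" "x = t *\<^sub>R z"
    by blast
  have "(1 - (t + 1) / 2) *\<^sub>R (- z) + ((t + 1) / 2) *\<^sub>R z = ((t + 1) / 2 - (1 - (t + 1) / 2)) *\<^sub>R z"
    by (simp only: scaleR_minus_right scaleR_diff_left) simp
  also have "(t + 1) / 2 - (1 - (t + 1) / 2) = t"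
    by (simp add: field_simps)
  finally show "x \<in> closed_segment (- z) z"
    using t unfolding closed_segment_def by (intro CollectI exI[of _ "(t + 1) / 2"]) auto
qed

lemma mem_sum_segments:
  fixes z :: "'i \<Rightarrow> 'a::real_vector"
  assumes "finite I"
  shows "x \<in> (\<Sum>i\<in>I. closed_segment (- z i) (z i)) \<longleftrightarrow>
    (\<exists>t. (\<forall>i\<in>I. \<bar>t i\<bar> \<le> 1) \<and> x = (\<Sum>i\<in>I. t i *\<^sub>R z i))"
proof
  assume "x \<in> (\<Sum>i\<in>I. closed_segment (- z i) (z i))"
  then obtain s where s: "x = sum s I" "\<forall>i\<in>I. s i \<in> closed_segment (- z i) (z i)"
    unfolding set_sum_alt[OF assms] by auto
  then obtain t where "\<forall>i\<in>I. \<bar>t i\<bar> \<le> 1 \<and> s i = t i *\<^sub>R z i"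
    unfolding mem_segment_symmetric by metis
  then show "\<exists>t. (\<forall>i\<in>I. \<bar>t i\<bar> \<le> 1) \<and> x = (\<Sum>i\<in>I. t i *\<^sub>R z i)"
    using s by (intro exI[of _ t]) auto
next
  assume "\<exists>t. (\<forall>i\<in>I. \<bar>t i\<bar> \<le> 1) \<and> x = (\<Sum>i\<in>I. t i *\<^sub>R z i)"
  then obtain t where t: "\<forall>i\<in>I. \<bar>t i\<bar> \<le> 1" "x = (\<Sum>i\<in>I. t i *\<^sub>R z i)"
    by blast
  then have "\<forall>i\<in>I. t i *\<^sub>R z i \<in> closed_segment (- z i) (z i)"
    unfolding mem_segment_symmetric by blast
  then show "x \<in> (\<Sum>i\<in>I. closed_segment (- z i) (z i))"
    unfolding set_sum_alt[OF assms] t(2) by (intro CollectI exI conjI) (rule refl)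
qed

lemma mem_standard_cube: "x \<in> standard_cube \<longleftrightarrow> (\<forall>i. \<bar>x $ i\<bar> \<le> 1)"
proof -
  have "(\<Sum>i\<in>UNIV. t i *\<^sub>R axis i 1) = (\<chi> i. t i)" for t :: "'a \<Rightarrow> real"
    by (simp add: vec_eq_iff axis_def if_distrib cong: if_cong)
  then have "x \<in> standard_cube \<longleftrightarrow> (\<exists>t. (\<forall>i. \<bar>t i\<bar> \<le> 1) \<and> x = (\<chi> i. t i))"
    by (simp add: standard_cube_def mem_sum_segments)
  then show ?thesis
    by (metis vec_lambda_beta vec_lambda_eta)
qed

lemma standard_cube_eq_cbox: "standard_cube = cbox (- vec 1) (vec 1 :: real^'n)"
proof -
  have "\<bar>r\<bar> \<le> 1 \<longleftrightarrow> - 1 \<le> r \<and> r \<le> 1" for r :: real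
    by auto
  then show ?thesis
    by (simp add: set_eq_iff mem_standard_cube mem_box_cart)
qed

lemma compact_standard_cube: "compact (standard_cube :: (real^'n) set)"
  by (simp add: standard_cube_eq_cbox)

lemma measure_standard_cube: "measure lborel (standard_cube :: (real^'n) set) = 2 ^ CARD('n)"
proof -
  have "0 \<in> cbox (- vec 1) (vec 1 :: real^'n)"
    by (simp add: mem_box_cart)
  then have "cbox (- vec 1) (vec 1 :: real^'n) \<noteq> {}"
    by blast
  then show ?thesis
    by (simp add: standard_cube_eq_cbox content_cbox_cart)
qed

lemma negligible_coordinate_hyperplane: "negligible {x::real^'n. x $ i = c}"
proof -
  have "negligible {x::real^'n. axis i 1 \<bullet> x = c}"
    by (rule negligible_hyperplane) (simp add: axis_eq_0_iff)
  then show ?thesis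
    by (simp add: inner_axis')
qed

text \<open>
  The hyperplane \<open>x_i = 0\<close> cuts the cube into two affine copies of itself. This self-similarity
  determines all first and second moments: it turns each of them into a solvable linear equation,
  for instance \<open>m = m/4 + V/4\<close> for the integral \<open>m\<close> of \<open>x_i\<^sup>2\<close> over the cube of volume \<open>V\<close>.
\<close>

lemma integral_cube_halves:
  fixes f :: "real^'n \<Rightarrow> real" and i :: 'n
  assumes "continuous_on UNIV f"
  defines "h \<equiv> \<lambda>s x. \<chi> j. if j = i then (x $ i + s) / 2 else x $ j"
  shows "(LINT x:standard_cube|lborel. f x) =
    (LINT x:standard_cube|lborel. f (h 1 x)) / 2 + (LINT x:standard_cube|lborel. f (h (- 1) x)) / 2"
proof -
  let ?C = "standard_cube :: (real^'n) set"
  define A :: "real^'n^'n" where "A = (\<chi> j k. if j = k then (if j = i then 1/2 else 1) else 0)"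
  have h: "h s = (\<lambda>x. A *v x + axis i (s/2))" for s
    by (simp add: fun_eq_iff vec_eq_iff h_def A_def matrix_vector_mult_def axis_def if_distribR
        if_distrib[of "\<lambda>x. x * y" for y] add_divide_distrib cong: if_cong)
  have "det A = (\<Prod>j\<in>UNIV. if j = i then 1/2 else 1)"
    by (subst det_diagonal) (auto simp: A_def)
  then have A: "det A = 1/2"
    by simp
  have halves: "?C = (\<Union>s\<in>{1, -1}. h s ` ?C)"
  proof (intro subset_antisym subsetI)
    fix x assume x: "x \<in> ?C"
    define s where "s = (if x $ i \<ge> 0 then 1 else - 1 :: real)"
    define y where "y = (\<chi> j. if j = i then 2 * x $ i - s else x $ j)"
    have "\<bar>2 * x $ i - s\<bar> \<le> 1"
      using x[unfolded mem_standard_cube, rule_format, of i] by (auto simp: s_def)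
    then have "y \<in> ?C"
      using x by (simp add: mem_standard_cube y_def)
    moreover have "x = h s y"
      by (simp add: h_def y_def vec_eq_iff)
    ultimately have "x \<in> h s ` ?C"
      by blast
    moreover have "s \<in> {1, -1}"
      by (simp add: s_def)
    ultimately show "x \<in> (\<Union>s\<in>{1, -1}. h s ` ?C)"
      by blast
  next
    fix x assume "x \<in> (\<Union>s\<in>{1, -1}. h s ` ?C)"
    then obtain s y where s: "s = 1 \<or> s = -1" and y: "y \<in> ?C" "x = h s y"
      by auto
    have "\<bar>(y $ i + s) / 2\<bar> \<le> 1"
      using y(1)[unfolded mem_standard_cube, rule_format, of i] s by auto
    then show "x \<in> ?C"
      using y by (simp add: mem_standard_cube h_def)
  qed
  have "x $ i \<ge> 0" if mem: "x \<in> h 1 ` ?C" for x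
  proof -
    obtain y where y: "y \<in> ?C" "x = h 1 y"
      using mem by blast
    show ?thesis
      using y(1)[unfolded mem_standard_cube, rule_format, of i] y(2) by (simp add: h_def)
  qed
  moreover have "x $ i \<le> 0" if mem: "x \<in> h (- 1) ` ?C" for x
  proof -
    obtain y where y: "y \<in> ?C" "x = h (- 1) y"
      using mem by blast
    show ?thesis
      using y(1)[unfolded mem_standard_cube, rule_format, of i] y(2) by (simp add: h_def)
  qed
  ultimately have "h 1 ` ?C \<inter> h (- 1) ` ?C \<subseteq> {x. x $ i = 0}"
    by fastforce
  then have "negligible (h 1 ` ?C \<inter> h (- 1) ` ?C)"
    using negligible_coordinate_hyperplane negligible_subset by blast
  then have "(LINT x:(\<Union>s\<in>{1, -1}. h s ` ?C)|lborel. f x) = (\<Sum>s\<in>{1, -1}. LINT x:h s ` ?C|lborel. f x)"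
    by (intro set_integral_Union_negligible assms(1))
       (auto simp: h pairwise_def Int_commute intro: compact_affine_image compact_standard_cube)
  also have "\<dots> = (\<Sum>s\<in>{1, -1}. (LINT x:?C|lborel. f (h s x)) / 2)"
    unfolding h
    by (intro sum.cong refl)
       (simp add: integral_affine_image A compact_standard_cube assms(1) borel_measurable_continuous_onI)
  finally show ?thesis
    using halves by simp
qed

lemma first_moment_cube: "first_moment (standard_cube :: (real^'n) set) = 0"
  and second_moment_cube: "second_moment (standard_cube :: (real^'n) set) = (2 ^ CARD('n) / 3) *\<^sub>R mat 1"
proof -
  let ?C = "standard_cube :: (real^'n) set" and ?V = "2 ^ CARD('n) :: real"
  have int: "set_integrable lborel ?C f" if "continuous_on UNIV f" for f :: "real^'n \<Rightarrow> real"
    using that compact_standard_cube continuous_on_subset set_integrable_compact by blast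
  have cont: "continuous_on UNIV (\<lambda>x::real^'n. x $ i)" "continuous_on UNIV (\<lambda>x::real^'n. x $ i * x $ j)" for i j
    by (intro continuous_intros)+
  have const: "(LINT x:?C|lborel. c) = ?V * c" for c :: real
    using compact_standard_cube
    by (simp add: set_lebesgue_integral_def borel_compact measure_standard_cube)
  have I: "set_integrable lborel ?C (\<lambda>x. x $ i * c)" "set_integrable lborel ?C (\<lambda>x. x $ i * x $ j * c)"
    "set_integrable lborel ?C (\<lambda>x. x $ i)" "set_integrable lborel ?C (\<lambda>x. x $ i * x $ j)"
    "set_integrable lborel ?C (\<lambda>x. c)" for i j c
    by (intro int continuous_intros)+
  have m1: "(LINT x:?C|lborel. x $ i) = 0" for i
  proof -
    have half: "(LINT x:?C|lborel. (x $ i + s) / 2) = ((LINT x:?C|lborel. x $ i) + ?V * s) / 2" for s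
      by (simp only: set_integral_divide_zero set_integral_add I const)
    have "(LINT x:?C|lborel. x $ i) = (LINT x:?C|lborel. (x $ i + 1) / 2) / 2 + (LINT x:?C|lborel. (x $ i + (- 1)) / 2) / 2"
      using integral_cube_halves[OF cont(1), of i i] by (simp only: vec_lambda_beta if_True if_False simp_thms)
    also have "\<dots> = ((LINT x:?C|lborel. x $ i) + ?V * 1) / 2 / 2 + ((LINT x:?C|lborel. x $ i) + ?V * (- 1)) / 2 / 2"
      by (simp only: half)
    finally show ?thesis
      by (simp add: add_divide_distrib diff_divide_distrib)
  qed
  have off: "(LINT x:?C|lborel. x $ i * x $ j) = 0" if "i \<noteq> j" for i j
  proof -
    have half: "(LINT x:?C|lborel. (x $ i + s) / 2 * x $ j) = (LINT x:?C|lborel. x $ i * x $ j) / 2" for s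
    proof -
      have "(LINT x:?C|lborel. (x $ i + s) / 2 * x $ j) = (LINT x:?C|lborel. (x $ i * x $ j + x $ j * s) / 2)"
        by (simp add: algebra_simps)
      also have "\<dots> = (LINT x:?C|lborel. x $ i * x $ j) / 2"
        by (simp only: set_integral_divide_zero set_integral_add I m1 set_integral_mult_left) simp
      finally show ?thesis .
    qed
    have "(LINT x:?C|lborel. x $ i * x $ j) = (LINT x:?C|lborel. (x $ i + 1) / 2 * x $ j) / 2 + (LINT x:?C|lborel. (x $ i + (- 1)) / 2 * x $ j) / 2"
      using integral_cube_halves[OF cont(2), of i j i] that[symmetric] by (simp only: vec_lambda_beta if_True if_False simp_thms)
    also have "\<dots> = (LINT x:?C|lborel. x $ i * x $ j) / 2 / 2 + (LINT x:?C|lborel. x $ i * x $ j) / 2 / 2"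
      by (simp only: half)
    finally show ?thesis
      by simp
  qed
  have diag: "(LINT x:?C|lborel. x $ i * x $ i) = ?V / 3" for i
  proof -
    have half: "(LINT x:?C|lborel. (x $ i + s) / 2 * ((x $ i + s) / 2)) =
        ((LINT x:?C|lborel. x $ i * x $ i) + ?V * s\<^sup>2) / 4" for s
    proof -
      have "(LINT x:?C|lborel. (x $ i + s) / 2 * ((x $ i + s) / 2)) =
          (LINT x:?C|lborel. (x $ i * x $ i + x $ i * (2 * s) + s\<^sup>2) / 4)"
        by (simp add: algebra_simps power2_eq_square)
      also have "\<dots> = ((LINT x:?C|lborel. x $ i * x $ i) + ?V * s\<^sup>2) / 4"
        by (simp only: set_integral_divide_zero set_integral_add I m1 const set_integral_mult_left) simp
      finally show ?thesis .
    qed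
    have "(LINT x:?C|lborel. x $ i * x $ i) = (LINT x:?C|lborel. (x $ i + 1) / 2 * ((x $ i + 1) / 2)) / 2 + (LINT x:?C|lborel. (x $ i + (- 1)) / 2 * ((x $ i + (- 1)) / 2)) / 2"
      using integral_cube_halves[OF cont(2), of i i i] by (simp only: vec_lambda_beta if_True if_False simp_thms)
    also have "\<dots> = ((LINT x:?C|lborel. x $ i * x $ i) + ?V * 1\<^sup>2) / 4 / 2 + ((LINT x:?C|lborel. x $ i * x $ i) + ?V * (- 1)\<^sup>2) / 4 / 2"
      by (simp only: half)
    finally show ?thesis
      by simp
  qed
  show "first_moment ?C = 0"
    by (simp add: first_moment_def vec_eq_iff m1)
  show "second_moment ?C = (?V / 3) *\<^sub>R mat 1"
    by (simp add: second_moment_def vec_eq_iff mat_def off diag)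
qed

section \<open>Determinant of a diagonal matrix plus a rank-one matrix\<close>

lemma matrix_add_rdistrib: "(M + N) ** Q = M ** Q + N ** Q" for M N Q :: "real^'n^'n"
  by (simp add: vec_eq_iff matrix_matrix_mult_def distrib_right sum.distrib)

text \<open>
  The idea is a change of basis that turns \<open>v\<^sup>T\<close> into a row of the identity matrix. If \<open>v_k \<noteq> 0\<close>, replace
  row \<open>k\<close> of the identity by \<open>v\<close> to obtain an invertible \<open>Q\<close>. Then \<open>Q (I + u v^T) Q^-1\<close> is
  \<open>I + (Q u) e_k^T\<close>, which differs from the identity only in column \<open>k\<close>, so that its determinant is
  its \<open>k\<close>-th diagonal entry \<open>1 + (Q u)_k\<close>.
\<close>

lemma det_identity_plus_outer: "det (mat 1 + outer u v) = 1 + u \<bullet> v" for u v :: "real^'n"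
proof (cases "v = 0")
  case True
  then have "outer u v = 0"
    by (simp add: vec_eq_iff)
  then show ?thesis
    using True by simp
next
  case False
  then obtain k where k: "v $ k \<noteq> 0"
    by (metis vec_eq_iff zero_index)
  have column: "det (\<chi> i j. if j = k then x $ i else mat 1 $ i $ j) = x $ k" for x :: "real^'n"
    using cramer_lemma[where A="mat 1" and k=k and x=x] unfolding matrix_vector_mul_lid by simp
  define Q :: "real^'n^'n" where "Q = (\<chi> i. if i = k then v else mat 1 $ i)"
  have "transpose Q = (\<chi> i j. if j = k then v $ i else mat 1 $ i $ j)"
    by (auto simp: Q_def transpose_def mat_def vec_eq_iff)
  then have Q: "det Q = v $ k"
    using column[of v] det_transpose[of Q] by simp
  have "(\<chi> i j. if j = k then (axis k 1 + Q *v u) $ i else mat 1 $ i $ j) = mat 1 + outer (Q *v u) (axis k 1)"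
    by (auto simp: vec_eq_iff axis_def mat_def)
  then have N: "det (mat 1 + outer (Q *v u) (axis k 1)) = 1 + (Q *v u) $ k"
    using column[of "axis k 1 + Q *v u"] by simp
  have "outer (Q *v u) (axis k 1) ** Q = outer (Q *v u) v"
    by (simp add: vec_eq_iff matrix_matrix_mult_def axis_def Q_def if_distrib if_distribR cong: if_cong)
  then have "Q ** (mat 1 + outer u v) = (mat 1 + outer (Q *v u) (axis k 1)) ** Q"
    by (simp add: matrix_add_ldistrib matrix_add_rdistrib matrix_mult_outer)
  then have "v $ k * det (mat 1 + outer u v) = (1 + (Q *v u) $ k) * v $ k"
    by (metis det_mul Q N)
  also have "(Q *v u) $ k = u \<bullet> v"
    by (simp add: Q_def matrix_vector_mult_def inner_vec_def mult.commute)
  finally show ?thesis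
    using k by simp
qed

lemma det_diagonal_plus_outer:
  fixes d u v :: "real^'n"
  assumes "\<And>i. d $ i \<noteq> 0"
  shows "det ((\<chi> i j. if i = j then d $ i else 0) + outer u v) =
    (\<Prod>i\<in>UNIV. d $ i) * (1 + (\<Sum>i\<in>UNIV. u $ i * v $ i / d $ i))"
proof -
  let ?D = "(\<chi> i j. if i = j then d $ i else 0) :: real^'n^'n"
  let ?u = "(\<chi> i. u $ i / d $ i) :: real^'n"
  have "?D *v ?u = u"
    using assms by (simp add: vec_eq_iff matrix_vector_mult_def if_distribR if_distrib cong: if_cong)
  then have "?D + outer u v = ?D ** (mat 1 + outer ?u v)"
    by (simp add: matrix_add_ldistrib matrix_mult_outer)
  moreover have "det ?D = (\<Prod>i\<in>UNIV. d $ i)"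
    by (subst det_diagonal) auto
  ultimately show ?thesis
    using det_identity_plus_outer[of ?u v] by (simp add: det_mul inner_vec_def)
qed


section \<open>The extremal inequality\<close>

text \<open>
  For \<open>c = 1, 2\<close> the product \<open>(\<Prod>(1 + y_i)) (c - \<Sum> y_i/(1 + y_i))\<close> equals \<open>\<Sum>_k (c - k) e_k(y)\<close>, whose
  terms with \<open>k > c\<close> are nonpositive; discarding these leaves \<open>1\<close> and \<open>2 + \<Sum> y_i\<close>. For \<open>c = 1\<close> the
  term \<open>-e_2(y)\<close> is strictly negative once two of the variables are positive. Adjoining a variable
  \<open>y_k\<close> adds \<open>y_k\<close> times the same expression with \<open>c - 1\<close> in place of \<open>c\<close>, so the bound for each \<open>c\<close>
  comes by induction from the previous one.
\<close>

lemma prod_defect_le: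
  fixes y :: "'a \<Rightarrow> real"
  assumes "finite A" "\<And>i. i \<in> A \<Longrightarrow> 0 \<le> y i"
  shows "(\<Prod>i\<in>A. 1 + y i) * (1 - (\<Sum>i\<in>A. y i / (1 + y i))) \<le> 1"
    and "\<lbrakk>i \<in> A; j \<in> A; i \<noteq> j; 0 < y i; 0 < y j\<rbrakk> \<Longrightarrow>
      (\<Prod>i\<in>A. 1 + y i) * (1 - (\<Sum>i\<in>A. y i / (1 + y i))) < 1"
    and "(\<Prod>i\<in>A. 1 + y i) * (2 - (\<Sum>i\<in>A. y i / (1 + y i))) \<le> 2 + (\<Sum>i\<in>A. y i)"
proof -
  define P where "P A = (\<Prod>i\<in>A. 1 + y i)" for A
  define T where "T A = (\<Sum>i\<in>A. y i / (1 + y i))" for A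
  have step: "P (insert k B) * (c - T (insert k B)) = P B * (c - T B) + y k * (P B * (c - 1 - T B))"
    if "finite B" "k \<notin> B" "0 \<le> y k" for k B c
  proof -
    have "P (insert k B) = P B * (1 + y k)" "T (insert k B) = T B + y k / (1 + y k)"
      using that by (simp_all add: P_def T_def mult.commute)
    moreover define r where "r = y k / (1 + y k)"
    ultimately have PT: "P (insert k B) = P B * (1 + y k)" "T (insert k B) = T B + r"
      by simp_all
    have "P (insert k B) * (c - T (insert k B)) = P B * ((1 + y k) * (c - T B) - (1 + y k) * r)"
      unfolding PT by (simp add: algebra_simps)
    also have "(1 + y k) * r = y k"
      using that by (simp add: r_def)
    also have "P B * ((1 + y k) * (c - T B) - y k) = P B * (c - T B) + y k * (P B * (c - 1 - T B))"
      by (simp add: algebra_simps)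
    finally show ?thesis .
  qed
  have P: "P B > 0" and T: "T B \<ge> 0" if "\<And>i. i \<in> B \<Longrightarrow> 0 \<le> y i" for B
    using that by (auto simp: P_def T_def intro!: prod_pos sum_nonneg add_pos_nonneg)
  have one: "P A * (1 - T A) \<le> 1" if "finite A" "\<And>i. i \<in> A \<Longrightarrow> 0 \<le> y i" for A
    using that
  proof (induction A)
    case empty
    then show ?case by (simp add: P_def T_def)
  next
    case (insert k B)
    have "y k * (P B * (1 - 1 - T B)) \<le> 0"
      using insert.prems P[of B] T[of B] by (simp add: mult_nonneg_nonneg less_imp_le)
    then show ?case
      using step[of B k 1] insert by simp
  qed
  have strict: "P A * (1 - T A) < 1"
    if "finite A" "\<And>i. i \<in> A \<Longrightarrow> 0 \<le> y i" "i \<in> A" "j \<in> A" "i \<noteq> j" "0 < y i" "0 < y j" for A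
  proof -
    let ?B = "A - {i}"
    have A: "A = insert i ?B" "finite ?B" "i \<notin> ?B" "\<And>i. i \<in> ?B \<Longrightarrow> 0 \<le> y i"
      using that by auto
    have "y j / (1 + y j) \<le> T ?B"
      unfolding T_def using A(2,4) that by (intro member_le_sum) auto
    moreover have "y j / (1 + y j) > 0"
      using that by simp
    ultimately have "T ?B > 0"
      by linarith
    then have "y i * (P ?B * (1 - 1 - T ?B)) < 0"
      using P[of ?B] A(4) that by (simp add: mult_pos_pos)
    moreover have "P ?B * (1 - T ?B) \<le> 1"
      using one A by blast
    ultimately show ?thesis
      using step[of ?B i 1] A that by simp
  qed
  have two: "P A * (2 - T A) \<le> 2 + (\<Sum>i\<in>A. y i)" if "finite A" "\<And>i. i \<in> A \<Longrightarrow> 0 \<le> y i" for A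
    using that
  proof (induction A)
    case empty
    then show ?case by (simp add: P_def T_def)
  next
    case (insert k B)
    have "y k * (P B * (2 - 1 - T B)) \<le> y k * 1"
      using insert.prems one[of B] insert.hyps by (intro mult_left_mono) auto
    then show ?case
      using step[of B k 2] insert by simp
  qed
  show "(\<Prod>i\<in>A. 1 + y i) * (1 - (\<Sum>i\<in>A. y i / (1 + y i))) \<le> 1"
    using one[OF assms] by (simp add: P_def T_def)
  show "(\<Prod>i\<in>A. 1 + y i) * (2 - (\<Sum>i\<in>A. y i / (1 + y i))) \<le> 2 + (\<Sum>i\<in>A. y i)"
    using two[OF assms] by (simp add: P_def T_def)
  show "(\<Prod>i\<in>A. 1 + y i) * (1 - (\<Sum>i\<in>A. y i / (1 + y i))) < 1"
    if "i \<in> A" "j \<in> A" "i \<noteq> j" "0 < y i" "0 < y j"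
    using strict[OF assms that] by (simp add: P_def T_def)
qed

text \<open>
  This is \<open>det A_Z / vol(Z)^2\<close> for \<open>Z = C + [-w, w]\<close>, divided by the same quantity for \<open>C\<close>.
\<close>

definition det_ratio :: "real^'n \<Rightarrow> real" where
  "det_ratio w = (let S = 1 + (\<Sum>i\<in>UNIV. w $ i) in
     (\<Prod>i\<in>UNIV. 1 + 2 * w $ i / S) *
     (1 + (1 + 2 / S) * (\<Sum>i\<in>UNIV. (w $ i)\<^sup>2 / (1 + 2 * w $ i / S))) / S\<^sup>2)"

text \<open>
  Put \<open>y_i = 2 w_i/S\<close> and \<open>q = 2/S\<close>, so that \<open>q + \<Sum> y_i = 2\<close>. With \<open>P = \<Prod>(1 + y_i)\<close> and
  \<open>T = \<Sum> y_i/(1 + y_i)\<close> the ratio becomes \<open>(P (2 - T) + q P (1 - T)) / 4\<close>; the two summands are at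
  most \<open>2 + \<Sum> y_i\<close> and \<open>q\<close>, which add up to \<open>4\<close>.
\<close>

lemma det_ratio_le_1:
  fixes w :: "real^'n"
  assumes w: "\<And>i. 0 \<le> w $ i"
  shows "det_ratio w \<le> 1"
    and "\<lbrakk>i \<noteq> j; 0 < w $ i; 0 < w $ j\<rbrakk> \<Longrightarrow> det_ratio w < 1"
proof -
  define S where "S = 1 + (\<Sum>i\<in>UNIV. w $ i)"
  have S: "S \<ge> 1"
    using w by (simp add: S_def sum_nonneg)
  define y where "y i = 2 * w $ i / S" for i
  have y: "y i \<ge> 0" for i
    using w S by (simp add: y_def)
  define q where "q = 2 / S"
  have q: "q > 0" "S = 2 / q"
    using S by (simp_all add: q_def)
  define P where "P = (\<Prod>i\<in>UNIV. 1 + y i)"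
  define T where "T = (\<Sum>i\<in>UNIV. y i / (1 + y i))"
  have sum_y: "(\<Sum>i\<in>UNIV. y i) = 2 - q"
  proof -
    have "(\<Sum>i\<in>UNIV. y i) = 2 * (S - 1) / S"
      by (simp add: y_def S_def sum_distrib_left sum_divide_distrib)
    also have "\<dots> = 2 - q"
      using S by (simp add: q_def field_simps)
    finally show ?thesis .
  qed
  have "(w $ i)\<^sup>2 / (1 + y i) = S\<^sup>2 / 4 * (y i - y i / (1 + y i))" for i
  proof -
    have "(w $ i)\<^sup>2 = S\<^sup>2 / 4 * (y i)\<^sup>2"
      using S by (simp add: y_def power_mult_distrib power_divide)
    moreover have "y i - y i / (1 + y i) = (y i)\<^sup>2 / (1 + y i)"
      using y[of i] by (simp add: field_simps power2_eq_square)
    ultimately show ?thesis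
      by (simp only: times_divide_eq_right)
  qed
  then have "(\<Sum>i\<in>UNIV. (w $ i)\<^sup>2 / (1 + y i)) = S\<^sup>2 / 4 * (2 - q - T)"
    by (simp only: sum_distrib_left[symmetric] sum_subtractf sum_y T_def)
  then have "det_ratio w = P * (1 + (1 + q) * (S\<^sup>2 / 4 * (2 - q - T))) / S\<^sup>2"
    by (simp add: det_ratio_def Let_def S_def[symmetric] y_def[symmetric] P_def q_def)
  also have "\<dots> = P / S\<^sup>2 + P * ((1 + q) * (2 - q - T)) / 4"
    using S by (simp add: field_simps)
  also have "1 / S\<^sup>2 = q\<^sup>2 / 4"
    by (simp add: q_def power_divide)
  then have "P / S\<^sup>2 = P * q\<^sup>2 / 4"
    by (metis divide_inverse inverse_eq_divide times_divide_eq_right)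
  also have "P * q\<^sup>2 / 4 + P * ((1 + q) * (2 - q - T)) / 4 = (P * (2 - T) + q * (P * (1 - T))) / 4"
    by (simp add: field_simps power2_eq_square)
  finally have ratio: "det_ratio w = (P * (2 - T) + q * (P * (1 - T))) / 4" .
  have two: "P * (2 - T) \<le> 4 - q"
    using prod_defect_le(3)[of UNIV y] y by (simp add: P_def T_def sum_y)
  have "P * (1 - T) \<le> 1"
    using prod_defect_le(1)[of UNIV y] y by (simp add: P_def T_def)
  then have "q * (P * (1 - T)) \<le> q * 1"
    using q by (intro mult_left_mono) auto
  then show "det_ratio w \<le> 1"
    using two ratio by simp
  show "det_ratio w < 1" if "i \<noteq> j" "0 < w $ i" "0 < w $ j"
  proof -
    have "y i > 0" "y j > 0"
      using that S by (simp_all add: y_def)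
    then have "P * (1 - T) < 1"
      using prod_defect_le(2)[of UNIV y i j] y that(1) by (simp add: P_def T_def)
    then have "q * (P * (1 - T)) < q * 1"
      using q by (intro mult_strict_left_mono) auto
    then show ?thesis
      using two ratio by simp
  qed
qed

section \<open>The cube plus one segment\<close>

definition cube_plus_segment :: "real^'n \<Rightarrow> (real^'n) set" where
  "cube_plus_segment w = {s + t *\<^sub>R w | s t. s \<in> standard_cube \<and> \<bar>t\<bar> \<le> 1}"

lemma compact_cube_plus_segment: "compact (cube_plus_segment w)"
proof -
  have "cube_plus_segment w = {x + y | x y. x \<in> standard_cube \<and> y \<in> closed_segment (- w) w}"
    unfolding cube_plus_segment_def mem_segment_symmetric by auto
  then show ?thesis
    using compact_sums[OF compact_standard_cube compact_segment] by simp
qed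

text \<open>
  The identity with column \<open>i\<close> replaced by \<open>w\<close>: it fixes the directions inside the facet \<open>x_i = 1\<close>
  and sends the remaining direction to the sweeping direction \<open>w\<close>.
\<close>

definition facet_matrix :: "real^'n \<Rightarrow> 'n \<Rightarrow> real^'n^'n" where
  "facet_matrix w i = (\<chi> j k. if k = i then w $ j else mat 1 $ j $ k)"

text \<open>
  \<open>tile w None\<close> is \<open>C - w\<close>; \<open>tile w (Some i)\<close> is the prism over the facet \<open>x_i = 1\<close> with axis
  \<open>[-w, w]\<close>. The identity matrix is spelled out so that both have the form of an affine image.
\<close>

fun tile :: "real^'n \<Rightarrow> 'n option \<Rightarrow> (real^'n) set" where
  "tile w None = (\<lambda>x. mat 1 *v x + (- w)) ` standard_cube"
| "tile w (Some i) = (\<lambda>x. facet_matrix w i *v x + axis i 1) ` standard_cube"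

lemma det_facet_matrix: "det (facet_matrix w i) = w $ i"
  using cramer_lemma[where A="mat 1" and k=i and x=w] unfolding matrix_vector_mul_lid
  by (simp add: facet_matrix_def)

lemma facet_matrix_vector:
  "(facet_matrix w i *v y) $ j = y $ i * w $ j + (if j = i then 0 else y $ j)"
proof -
  have "(facet_matrix w i *v y) $ j = (\<Sum>k\<in>UNIV. (if k = i then y $ i * w $ j else 0) + (if k = j then (if j = i then 0 else y $ j) else 0))"
    unfolding facet_matrix_def matrix_vector_mult_def vec_lambda_beta
    by (rule sum.cong) (auto simp: mat_def)
  then show ?thesis
    by (simp add: sum.distrib)
qed

lemma facet_matrix_transpose:
  "facet_matrix w i ** transpose (facet_matrix w i) = mat 1 - outer (axis i 1) (axis i 1) + outer w w"
proof -
  have "(\<Sum>k\<in>UNIV. facet_matrix w i $ a $ k * facet_matrix w i $ b $ k)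
      = (\<Sum>k\<in>UNIV. (if k = i then w $ a * w $ b - of_bool (a = i) * of_bool (b = i) else 0)
          + (if k = a then of_bool (a = b) else 0))" for a b
    by (rule sum.cong) (auto simp: facet_matrix_def mat_def)
  then show ?thesis
    by (simp add: vec_eq_iff matrix_matrix_mult_def transpose_def sum.distrib mat_def axis_def)
qed

lemma compact_tile: "compact (tile w k)"
  by (cases k) (simp_all only: tile.simps compact_affine_image compact_standard_cube)

lemma tile_moments:
  fixes w :: "real^'n"
  defines "V \<equiv> 2 ^ CARD('n) :: real"
  shows "measure lborel (tile w None) = V"
    and "first_moment (tile w None) = V *\<^sub>R (- w)"
    and "second_moment (tile w None) = V *\<^sub>R ((1/3) *\<^sub>R mat 1 + outer w w)"
    and "w $ i > 0 \<Longrightarrow> measure lborel (tile w (Some i)) = w $ i * V"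
    and "w $ i > 0 \<Longrightarrow> first_moment (tile w (Some i)) = (w $ i * V) *\<^sub>R axis i 1"
    and "w $ i > 0 \<Longrightarrow> second_moment (tile w (Some i)) =
      (w $ i * V) *\<^sub>R ((1/3) *\<^sub>R (mat 1 + 2 *\<^sub>R outer (axis i 1) (axis i 1) + outer w w))"
proof -
  have 1: "det (mat 1 :: real^'n^'n) \<noteq> 0"
    by simp
  show "measure lborel (tile w None) = V"
    "first_moment (tile w None) = V *\<^sub>R (- w)"
    "second_moment (tile w None) = V *\<^sub>R ((1/3) *\<^sub>R mat 1 + outer w w)"
    unfolding tile.simps measure_affine_image[OF 1 compact_standard_cube]
      first_moment_affine_image[OF 1 compact_standard_cube]
      second_moment_affine_image[OF 1 compact_standard_cube]
      measure_standard_cube first_moment_cube second_moment_cube V_def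
    by (simp_all add: vec_eq_iff algebra_simps)
  have M: "A ** (c *\<^sub>R mat 1) ** transpose A = c *\<^sub>R (A ** transpose A)" for A :: "real^'n^'n" and c
    using congruence_linear[of A c "mat 1" 0] by simp
  assume w: "w $ i > 0"
  then have 2: "det (facet_matrix w i) \<noteq> 0"
    by (simp add: det_facet_matrix)
  show "measure lborel (tile w (Some i)) = w $ i * V"
    "first_moment (tile w (Some i)) = (w $ i * V) *\<^sub>R axis i 1"
    "second_moment (tile w (Some i)) =
      (w $ i * V) *\<^sub>R ((1/3) *\<^sub>R (mat 1 + 2 *\<^sub>R outer (axis i 1) (axis i 1) + outer w w))"
    unfolding tile.simps measure_affine_image[OF 2 compact_standard_cube]
      first_moment_affine_image[OF 2 compact_standard_cube]
      second_moment_affine_image[OF 2 compact_standard_cube]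
      measure_standard_cube first_moment_cube second_moment_cube det_facet_matrix
      M facet_matrix_transpose
    using w by (simp_all add: V_def vec_eq_iff algebra_simps)
qed

text \<open>
  Write \<open>x\<close> in \<open>C + [-w, w]\<close> as \<open>y + t w\<close> with \<open>y\<close> in \<open>C\<close> and the least possible \<open>t \<ge> -1\<close>. Either
  \<open>t = -1\<close>, and \<open>x\<close> lies in \<open>C - w\<close>, or decreasing \<open>t\<close> is obstructed by some constraint \<open>y_i \<le> 1\<close>
  with \<open>w_i > 0\<close>, so that \<open>y\<close> lies on the facet \<open>x_i = 1\<close>. Facets with \<open>w_i = 0\<close> sweep out null sets
  and are left out, which keeps all matrices invertible.
\<close>

lemma cube_plus_segment_tiling:
  fixes w :: "real^'n"
  assumes w: "\<And>i. 0 \<le> w $ i"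
  shows "cube_plus_segment w = (\<Union>k\<in>insert None (Some ` {i. w $ i > 0}). tile w k)"
proof (intro subset_antisym subsetI)
  fix x assume "x \<in> cube_plus_segment w"
  then obtain s t where x: "x = s + t *\<^sub>R w" and s: "\<And>i. \<bar>s $ i\<bar> \<le> 1" and t: "\<bar>t\<bar> \<le> 1"
    by (auto simp: cube_plus_segment_def mem_standard_cube)
  define E where "E = insert (- 1) ((\<lambda>i. (x $ i - 1) / w $ i) ` {i. w $ i > 0})"
  \<comment> \<open>the least \<open>t \<ge> -1\<close> for which \<open>x - t w\<close> satisfies all upper constraints\<close>
  define t0 where "t0 = Max E"
  define y where "y = x - t0 *\<^sub>R w"
  have E: "finite E" "E \<noteq> {}"
    by (simp_all add: E_def)
  have "e \<le> t" if "e \<in> E" for e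
    using that s t by (auto simp: E_def x abs_le_iff divide_le_eq)
  then have t0: "t0 \<le> t" "- 1 \<le> t0"
    using E by (auto simp: t0_def E_def)
  have "\<bar>y $ i\<bar> \<le> 1" for i
  proof (cases "w $ i > 0")
    case True
    then have "(x $ i - 1) / w $ i \<le> t0"
      unfolding t0_def using E by (intro Max_ge) (auto simp: E_def)
    then have "y $ i \<le> 1"
      using True by (simp add: y_def divide_le_eq)
    moreover have "t0 * w $ i \<le> t * w $ i"
      using t0 w by (intro mult_right_mono)
    then have "y $ i \<ge> - 1"
      using s[of i] by (simp add: y_def x)
    ultimately show ?thesis
      by simp
  next
    case False
    then have "w $ i = 0"
      using w[of i] by simp
    then show ?thesis
      using s[of i] by (simp add: y_def x)
  qed
  then have y: "y \<in> standard_cube"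
    by (simp add: mem_standard_cube)
  have "t0 \<in> E"
    unfolding t0_def using E by (rule Max_in)
  then consider "t0 = - 1" | i where "w $ i > 0" "t0 = (x $ i - 1) / w $ i"
    by (auto simp: E_def)
  then show "x \<in> (\<Union>k\<in>insert None (Some ` {i. w $ i > 0}). tile w k)"
  proof cases
    case 1
    then have "x = mat 1 *v y + (- w)"
      by (simp add: y_def)
    then have "x \<in> tile w None"
      unfolding tile.simps using y by (rule image_eqI)
    then show ?thesis
      by blast
  next
    case 2
    define z where "z = (\<chi> j. if j = i then t0 else y $ j)"
    have z: "z \<in> standard_cube"
      using y t0 t by (auto simp: z_def mem_standard_cube)
    have "y $ i = 1"
      using 2 by (simp add: y_def)
    then have "x = facet_matrix w i *v z + axis i 1"
      by (auto simp: vec_eq_iff facet_matrix_vector z_def y_def axis_def)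
    then have "x \<in> tile w (Some i)"
      unfolding tile.simps using z by (rule image_eqI)
    then show ?thesis
      using 2 by blast
  qed
next
  fix x assume "x \<in> (\<Union>k\<in>insert None (Some ` {i. w $ i > 0}). tile w k)"
  then consider "x \<in> tile w None" | i where "x \<in> tile w (Some i)"
    by blast
  then show "x \<in> cube_plus_segment w"
  proof cases
    case 1
    then obtain y where "y \<in> standard_cube" "x = y + (- 1) *\<^sub>R w"
      by auto
    then show ?thesis
      unfolding cube_plus_segment_def by (intro CollectI exI[of _ y] exI[of _ "- 1"]) simp
  next
    case 2
    then obtain y where y: "y \<in> standard_cube" "x = facet_matrix w i *v y + axis i 1"
      by auto
    define s where "s = (\<chi> j. if j = i then 1 else y $ j)"
    have "s \<in> standard_cube" "\<bar>y $ i\<bar> \<le> 1"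
      using y(1) by (auto simp: s_def mem_standard_cube)
    moreover have "x = s + (y $ i) *\<^sub>R w"
      by (auto simp: y(2) vec_eq_iff facet_matrix_vector s_def axis_def)
    ultimately show ?thesis
      unfolding cube_plus_segment_def by blast
  qed
qed

text \<open>
  Any two tiles meet inside a hyperplane. For two prisms with \<open>w_i, w_j > 0\<close>, a common point
  \<open>x\<close> has parameters \<open>t = (x_i - 1)/w_i\<close> and \<open>u = (x_j - 1)/w_j\<close>; each of the two facet constraints
  bounds one parameter by the other, so \<open>t = u\<close>. A prism with \<open>w_i = 0\<close> is itself flat.
\<close>

lemma negligible_tile_Int:
  fixes w :: "real^'n"
  assumes w: "\<And>i. 0 \<le> w $ i" and "k \<noteq> l"
  shows "negligible (tile w k \<inter> tile w l)"
proof -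
  have facet: "\<exists>t. \<bar>t\<bar> \<le> 1 \<and> x $ i = 1 + t * w $ i \<and> (\<forall>j. x $ j \<le> 1 + t * w $ j)"
    if x: "x \<in> tile w (Some i)" for x i
  proof -
    obtain y where "y \<in> standard_cube" and x: "x = facet_matrix w i *v y + axis i 1"
      using x by auto
    then have y: "\<bar>y $ j\<bar> \<le> 1" for j
      by (simp add: mem_standard_cube)
    then show ?thesis
      using x abs_le_D1[OF y] by (intro exI[of _ "y $ i"]) (simp add: facet_matrix_vector axis_def)
  qed
  have base: "negligible (tile w None \<inter> tile w (Some i))" for i
  proof (rule negligible_subset[OF negligible_coordinate_hyperplane])
    show "tile w None \<inter> tile w (Some i) \<subseteq> {x. x $ i = 1 - w $ i}"
    proof
      fix x assume x: "x \<in> tile w None \<inter> tile w (Some i)"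
      then obtain t where t: "\<bar>t\<bar> \<le> 1" "x $ i = 1 + t * w $ i"
        using facet by blast
      moreover have "- 1 * w $ i \<le> t * w $ i"
        using t w by (intro mult_right_mono) auto
      moreover have "x \<in> tile w None"
        using x by blast
      then obtain y where y: "y \<in> standard_cube" "x = y - w"
        by auto
      then have "\<bar>y $ i\<bar> \<le> 1"
        by (simp add: mem_standard_cube)
      ultimately show "x \<in> {x. x $ i = 1 - w $ i}"
        using y(2) by auto
    qed
  qed
  have facets: "negligible (tile w (Some i) \<inter> tile w (Some j))" if "i \<noteq> j" for i j
  proof (cases "w $ i = 0")
    case True
    then have "tile w (Some i) \<inter> tile w (Some j) \<subseteq> {x. x $ i = 1}"
      using facet by fastforce
    then show ?thesis
      using negligible_coordinate_hyperplane negligible_subset by blast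
  next
    case False
    let ?a = "w $ j *\<^sub>R axis i 1 - w $ i *\<^sub>R axis j 1 :: real^'n"
    have "?a $ j \<noteq> 0"
      using False that by (simp add: axis_def)
    then have "?a \<noteq> 0"
      by (metis zero_index)
    moreover have "tile w (Some i) \<inter> tile w (Some j) \<subseteq> {x. ?a \<bullet> x = w $ j - w $ i}"
    proof
      fix x assume x: "x \<in> tile w (Some i) \<inter> tile w (Some j)"
      obtain t where t: "x $ i = 1 + t * w $ i" "x $ j \<le> 1 + t * w $ j"
        using facet x by blast
      obtain u where u: "x $ j = 1 + u * w $ j" "x $ i \<le> 1 + u * w $ i"
        using facet x by blast
      have "t * w $ i \<le> u * w $ i" "u * w $ j \<le> t * w $ j"
        using t u by simp_all
      then have "t * w $ i * w $ j = u * w $ i * w $ j"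
        using False w[of i] w[of j] by (cases "w $ j = 0") auto
      then show "x \<in> {x. ?a \<bullet> x = w $ j - w $ i}"
        by (simp add: inner_diff_left inner_axis' t u algebra_simps)
    qed
    ultimately show ?thesis
      using negligible_hyperplane[of ?a] negligible_subset by blast
  qed
  show ?thesis
    using assms(2) base facets by (cases k; cases l) (auto simp: Int_commute simp del: tile.simps)
qed

lemma cube_plus_segment_moments:
  fixes w :: "real^'n"
  assumes w: "\<And>i. 0 \<le> w $ i"
  defines "V \<equiv> 2 ^ CARD('n) :: real" and "S \<equiv> 1 + (\<Sum>i\<in>UNIV. w $ i)"
  shows "measure lborel (cube_plus_segment w) = V * S"
    and "first_moment (cube_plus_segment w) = 0"
    and "second_moment (cube_plus_segment w) =
      (V / 3) *\<^sub>R ((\<chi> i j. if i = j then S + 2 * w $ i else 0) + (S + 2) *\<^sub>R outer w w)"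
proof -
  have tiles: "(LINT x:cube_plus_segment w|lborel. f x) =
      (LINT x:tile w None|lborel. f x) + (\<Sum>i | w $ i > 0. LINT x:tile w (Some i)|lborel. f x)"
    if "continuous_on UNIV f" for f :: "real^'n \<Rightarrow> real"
  proof -
    have "(LINT x:cube_plus_segment w|lborel. f x)
        = (\<Sum>k\<in>insert None (Some ` {i. w $ i > 0}). LINT x:tile w k|lborel. f x)"
      unfolding cube_plus_segment_tiling[OF w]
      by (intro set_integral_Union_negligible compact_tile that)
         (auto simp: pairwise_def intro: negligible_tile_Int[OF w] simp del: tile.simps)
    then show ?thesis
      by (simp add: sum.reindex del: tile.simps)
  qed
  have pos: "(\<Sum>i | w $ i > 0. w $ i * g i) = (\<Sum>i\<in>UNIV. w $ i * g i)" for g :: "'n \<Rightarrow> real"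
    using w by (intro sum.mono_neutral_left) (auto simp: less_le)
  have "measure lborel (cube_plus_segment w) =
      measure lborel (tile w None) + (\<Sum>i | w $ i > 0. measure lborel (tile w (Some i)))"
    using tiles[of "\<lambda>_. 1"]
    by (simp add: measure_eq_set_integral compact_tile compact_cube_plus_segment continuous_intros del: tile.simps)
  also have "\<dots> = V + (\<Sum>i | w $ i > 0. w $ i * V)"
    unfolding V_def by (simp add: tile_moments del: tile.simps)
  finally show "measure lborel (cube_plus_segment w) = V * S"
    unfolding pos by (simp add: S_def algebra_simps sum_distrib_left)
  have fm: "first_moment K $ a = (LINT x:K|lborel. x $ a)" for K :: "(real^'n) set" and a
    by (simp add: first_moment_def)
  have sm: "second_moment K $ a $ b = (LINT x:K|lborel. x $ a * x $ b)" for K :: "(real^'n) set" and a b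
    by (simp add: second_moment_def)
  have "first_moment (cube_plus_segment w) $ a = 0" for a
  proof -
    have "first_moment (cube_plus_segment w) $ a =
        first_moment (tile w None) $ a + (\<Sum>i | w $ i > 0. first_moment (tile w (Some i)) $ a)"
      unfolding fm by (intro tiles continuous_intros)
    also have "\<dots> = - V * w $ a + (\<Sum>i | w $ i > 0. w $ i * (V * axis i 1 $ a))"
      unfolding V_def by (simp add: tile_moments mult.assoc del: tile.simps)
    also have "\<dots> = 0"
      unfolding pos by (simp add: axis_def if_distrib cong: if_cong)
    finally show ?thesis .
  qed
  then show "first_moment (cube_plus_segment w) = 0"
    by (simp add: vec_eq_iff)
  have "second_moment (cube_plus_segment w) $ a $ b =
      V / 3 * ((if a = b then S + 2 * w $ a else 0) + (S + 2) * (w $ a * w $ b))" for a b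
  proof -
    \<comment> \<open>The tiles \<open>Some i\<close> are weighted by \<open>w $ i\<close>, so the sum may run over all \<open>i\<close>.\<close>
    have "second_moment (cube_plus_segment w) $ a $ b =
        second_moment (tile w None) $ a $ b + (\<Sum>i | w $ i > 0. second_moment (tile w (Some i)) $ a $ b)"
      unfolding sm by (intro tiles continuous_intros)
    also have "\<dots> = V * (of_bool (a = b) / 3 + w $ a * w $ b)
        + (\<Sum>i | w $ i > 0. w $ i * (V / 3 * (of_bool (a = b) + 2 * (axis i 1 $ a * axis i 1 $ b) + w $ a * w $ b)))"
      unfolding V_def by (simp add: tile_moments mult.assoc mat_def del: tile.simps)
    also have "\<dots> = V * (of_bool (a = b) / 3 + w $ a * w $ b)
        + V / 3 * (\<Sum>i\<in>UNIV. w $ i * (of_bool (a = b) + w $ a * w $ b) + (if i = a then 2 * w $ a * of_bool (a = b) else 0))"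
      unfolding pos sum_distrib_left
      by (intro arg_cong2[where f="(+)"] refl sum.cong) (auto simp: axis_def algebra_simps)
    also have "\<dots> = V * (of_bool (a = b) / 3 + w $ a * w $ b)
        + V / 3 * ((S - 1) * (of_bool (a = b) + w $ a * w $ b) + 2 * w $ a * of_bool (a = b))"
      by (simp add: sum.distrib S_def sum_distrib_right)
    also have "\<dots> = V / 3 * ((if a = b then S + 2 * w $ a else 0) + (S + 2) * (w $ a * w $ b))"
      by (simp add: field_simps)
    finally show ?thesis .
  qed
  then show "second_moment (cube_plus_segment w) =
      (V / 3) *\<^sub>R ((\<chi> i j. if i = j then S + 2 * w $ i else 0) + (S + 2) *\<^sub>R outer w w)"
    by (simp add: vec_eq_iff)
qed

lemma isotropic_constant_cube_plus_segment:
  fixes w :: "real^'n"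
  assumes w: "\<And>i. 0 \<le> w $ i"
  shows "isotropic_constant (cube_plus_segment w) =
    root (2 * CARD('n)) ((1/3) ^ CARD('n) / 4 ^ CARD('n) * det_ratio w)"
proof -
  let ?V = "2 ^ CARD('n) :: real"
  define S where "S = 1 + (\<Sum>i\<in>UNIV. w $ i)"
  have S: "S > 0"
    using w by (simp add: S_def add_pos_nonneg sum_nonneg)
  have vol: "measure lborel (cube_plus_segment w) = ?V * S"
    using cube_plus_segment_moments(1)[OF w] by (simp add: S_def)
  then have pos: "measure lborel (cube_plus_segment w) > 0"
    using S by simp
  have second: "second_moment (cube_plus_segment w) =
      (?V / 3) *\<^sub>R ((\<chi> i j. if i = j then S + 2 * w $ i else 0) + (S + 2) *\<^sub>R outer w w)"
    unfolding S_def by (rule cube_plus_segment_moments(3)[OF w])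
  have "covariance_matrix (cube_plus_segment w) =
      (1 / (?V * S)) *\<^sub>R ((?V / 3) *\<^sub>R ((\<chi> i j. if i = j then S + 2 * w $ i else 0) + (S + 2) *\<^sub>R outer w w))"
    unfolding covariance_matrix_eq_moments[OF compact_cube_plus_segment pos] vol second
      cube_plus_segment_moments(2)[OF w]
    by (simp add: vec_eq_iff)
  also have "\<dots> = (\<chi> i j. if i = j then (\<chi> i. (1 + 2 * w $ i / S) / 3) $ i else 0)
      + outer (((1 + 2 / S) / 3) *\<^sub>R w) w"
    using S by (simp add: vec_eq_iff field_simps)
  finally have "det (covariance_matrix (cube_plus_segment w)) =
      (\<Prod>i\<in>UNIV. (1 + 2 * w $ i / S) / 3) *
      (1 + (\<Sum>i\<in>UNIV. (1 + 2 / S) / 3 * w $ i * w $ i / ((1 + 2 * w $ i / S) / 3)))"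
  proof -
    have "1 + 2 * w $ i / S \<noteq> 0" for i
      using S w[of i] by (smt (verit) divide_nonneg_pos)
    then show ?thesis
      if "covariance_matrix (cube_plus_segment w) = (\<chi> i j. if i = j then (\<chi> i. (1 + 2 * w $ i / S) / 3) $ i else 0)
      + outer (((1 + 2 / S) / 3) *\<^sub>R w) w"
      unfolding that by (subst det_diagonal_plus_outer) simp_all
  qed
  also have "(\<Prod>i\<in>UNIV. (1 + 2 * w $ i / S) / 3) = (1/3) ^ CARD('n) * (\<Prod>i\<in>UNIV. 1 + 2 * w $ i / S)"
    by (simp add: prod_dividef power_divide)
  also have "(\<Sum>i\<in>UNIV. (1 + 2 / S) / 3 * w $ i * w $ i / ((1 + 2 * w $ i / S) / 3))
      = (1 + 2 / S) * (\<Sum>i\<in>UNIV. (w $ i)\<^sup>2 / (1 + 2 * w $ i / S))"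
    unfolding sum_distrib_left by (intro sum.cong refl) (simp add: power2_eq_square)
  finally have "det (covariance_matrix (cube_plus_segment w)) = (1/3) ^ CARD('n) * (det_ratio w * S\<^sup>2)"
    using S by (simp add: det_ratio_def S_def[symmetric] Let_def)
  moreover have "(measure lborel (cube_plus_segment w))\<^sup>2 = 4 ^ CARD('n) * S\<^sup>2"
    unfolding vol power_mult_distrib by (simp add: power2_eq_square flip: power_mult_distrib)
  ultimately show ?thesis
    using S by (simp add: isotropic_constant_def)
qed

section \<open>Reduction to the cube plus one segment\<close>

lemma standard_cube_eq_cube_plus_segment: "standard_cube = cube_plus_segment 0"
  by (auto simp: cube_plus_segment_def intro: exI[of _ "0::real"])

text \<open>
  Otherwise the zonotope would lie in a translate of a proper subspace and have empty interior.
\<close>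

lemma zonotope_spanning:
  fixes z :: "nat \<Rightarrow> real^'n"
  assumes Z: "Z = {c} + (\<Sum>i<m. closed_segment (- z i) (z i))" and "interior Z \<noteq> {}"
  shows "span (z ` {..<m}) = UNIV"
proof -
  let ?G = "z ` {..<m}"
  have "(\<Sum>i<m. closed_segment (- z i) (z i)) \<subseteq> span ?G"
  proof
    fix x assume "x \<in> (\<Sum>i<m. closed_segment (- z i) (z i))"
    then obtain t where "x = (\<Sum>i<m. t i *\<^sub>R z i)"
      by (auto simp: mem_sum_segments)
    then show "x \<in> span ?G"
      by (simp only:) (intro span_sum span_scale span_base imageI)
  qed
  then have "Z \<subseteq> (+) c ` span ?G"
    unfolding Z by (auto simp: set_plus_def)
  then have "interior ((+) c ` span ?G) \<noteq> {}"
    using assms(2) interior_mono by blast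
  then have "interior (span ?G) \<noteq> {}"
    by (simp add: interior_translation)
  then have "\<not> dim (span ?G) < DIM(real^'n)"
    using empty_interior_lowdim by blast
  then have "dim ?G = DIM(real^'n)"
    using dim_subset_UNIV[of ?G] by simp
  then show ?thesis
    using dim_eq_full by blast
qed

text \<open>
  The generators span the whole space, so \<open>n\<close> of them form a basis, and the at most one index left
  over gives a vector \<open>u\<close> (zero if there is none). The map sending the standard basis to that basis
  turns the zonotope into \<open>C + [-w0, w0]\<close>. Replacing basis vectors by their negatives where \<open>w0\<close> is
  negative does not change their segments and makes \<open>w\<close> nonnegative.
\<close>

lemma zonotope_normal_form:
  fixes Z :: "(real^'n) set"
  assumes "zonotope_with_generators m Z" and m: "m \<le> CARD('n) + 1" and "interior Z \<noteq> {}"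
  obtains A :: "real^'n^'n" and c w where "det A \<noteq> 0" "\<And>i. 0 \<le> w $ i"
    "Z = (\<lambda>x. A *v x + c) ` cube_plus_segment w"
proof -
  obtain c z where Z: "Z = {c} + (\<Sum>i<m. closed_segment (- z i) (z i))"
    using assms(1) unfolding zonotope_with_generators_def by blast
  have span: "span (z ` {..<m}) = UNIV"
    using zonotope_spanning[OF Z assms(3)] .
  obtain B where B: "B \<subseteq> z ` {..<m}" "independent B" "z ` {..<m} \<subseteq> span B" "card B = dim (z ` {..<m})"
    using basis_exists by blast
  have "span B = UNIV"
    using B(3) span by (metis span_mono span_span top.extremum_uniqueI)
  have "card B = CARD('n)"
    using B(4) span by (metis dim_UNIV dim_span DIM_cart DIM_real mult.right_neutral)
  moreover have "finite B"
    using B(1) finite_subset by blast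
  ultimately obtain g where g: "bij_betw g (UNIV :: 'n set) B"
    using finite_same_card_bij[of "UNIV :: 'n set" B] by auto
  \<comment> \<open>\<open>\<phi>\<close> selects generator indices for the basis; using indices allows for repeated generators.\<close>
  define \<phi> where "\<phi> i = inv_into {..<m} z (g i)" for i
  have gB: "g i \<in> z ` {..<m}" for i
    using g B(1) by (auto simp: bij_betw_def)
  have z\<phi>: "z (\<phi> i) = g i" and \<phi>m: "\<phi> i < m" for i
    using f_inv_into_f[OF gB] inv_into_into[OF gB] by (simp_all add: \<phi>_def)
  have inj: "inj \<phi>"
    using g z\<phi> by (metis bij_betw_imp_inj_on injD injI)
  define J where "J = {..<m} - range \<phi>"
  have "range \<phi> \<subseteq> {..<m}"
    using \<phi>m by blast
  then have "card J = m - CARD('n)"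
    by (simp add: J_def card_Diff_subset card_image inj)
  then consider "card J = 0" | "card J = 1"
    using m by linarith
  then have J: "J = {} \<or> (\<exists>j. J = {j})"
    by cases (simp_all add: J_def card_1_singleton_iff)
  define u where "u = (\<Sum>j\<in>J. z j)"

  define A0 :: "real^'n^'n" where "A0 = (\<chi> j i. g i $ j)"
  have "columns A0 = B"
    using g by (auto simp: columns_def column_def A0_def vec_lambda_eta bij_betw_def)
  then have "invertible A0"
    using \<open>span B = UNIV\<close> matrix_right_invertible_span_columns[of A0]
    by (simp add: invertible_right_inverse span_vec_eq)
  then obtain w0 where w0: "A0 *v w0 = u"
    by (metis invertible_def matrix_vector_mul_assoc matrix_vector_mul_lid)
  define \<sigma> where "\<sigma> i = (if w0 $ i < 0 then - 1 else 1 :: real)" for i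
  define w where "w = (\<chi> i. \<bar>w0 $ i\<bar>)"
  define D :: "real^'n^'n" where "D = (\<chi> i j. if i = j then \<sigma> i else 0)"
  have Dv: "D *v x = (\<chi> i. \<sigma> i * x $ i)" for x
    by (simp add: D_def vec_eq_iff matrix_vector_mult_def if_distribR if_distrib[of "\<lambda>x. x * y" for y] cong: if_cong)
  define A where "A = A0 ** D"
  have "det D = (\<Prod>i\<in>UNIV. \<sigma> i)"
    unfolding D_def by (subst det_diagonal) auto
  then have "det D \<noteq> 0"
    by (simp add: \<sigma>_def)
  then have detA: "det A \<noteq> 0"
    using \<open>invertible A0\<close> by (simp add: A_def det_mul invertible_det_nz)
  have Av: "A *v x = (\<Sum>i\<in>UNIV. (\<sigma> i * x $ i) *\<^sub>R g i)" for x
    unfolding A_def by (simp add: matrix_vector_mul_assoc[symmetric] Dv)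
      (simp add: A0_def vec_eq_iff matrix_vector_mult_def mult.commute)
  have "D *v w = w0"
    by (simp add: Dv w_def \<sigma>_def vec_eq_iff)
  then have Aw: "A *v w = u"
    using w0 by (simp add: A_def matrix_vector_mul_assoc[symmetric])
  have split: "(\<Sum>i<m. t i *\<^sub>R z i) = (\<Sum>i\<in>UNIV. t (\<phi> i) *\<^sub>R g i) + (\<Sum>j\<in>J. t j *\<^sub>R z j)" for t :: "nat \<Rightarrow> real"
  proof -
    have "(\<Sum>i<m. t i *\<^sub>R z i) = (\<Sum>j\<in>J. t j *\<^sub>R z j) + (\<Sum>i\<in>range \<phi>. t i *\<^sub>R z i)"
      unfolding J_def using \<open>range \<phi> \<subseteq> {..<m}\<close> by (intro sum.subset_diff) auto
    also have "(\<Sum>i\<in>range \<phi>. t i *\<^sub>R z i) = (\<Sum>i\<in>UNIV. t (\<phi> i) *\<^sub>R g i)"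
      using inj by (simp add: sum.reindex z\<phi>)
    finally show ?thesis
      by (simp add: add.commute)
  qed
  have "Z = (\<lambda>x. A *v x + c) ` cube_plus_segment w"
  proof (intro subset_antisym subsetI)
    fix x assume "x \<in> Z"
    then obtain y where "y \<in> (\<Sum>i<m. closed_segment (- z i) (z i))" "x = c + y"
      unfolding Z by (auto simp: set_plus_def)
    then obtain t where "\<forall>i\<in>{..<m}. \<bar>t i\<bar> \<le> 1" and tx: "x = c + (\<Sum>i<m. t i *\<^sub>R z i)"
      unfolding mem_sum_segments[OF finite_lessThan] by blast
    then have t: "\<bar>t i\<bar> \<le> 1" if "i < m" for i
      using that by blast
    define s where "s = (\<chi> i. \<sigma> i * t (\<phi> i))"
    have s: "s \<in> standard_cube"
      using t \<phi>m by (simp add: s_def mem_standard_cube \<sigma>_def)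
    have "\<exists>\<tau>. \<bar>\<tau>\<bar> \<le> 1 \<and> (\<Sum>j\<in>J. t j *\<^sub>R z j) = \<tau> *\<^sub>R u"
    proof (cases "J = {}")
      case True
      then show ?thesis
        by (intro exI[of _ 0]) (simp add: u_def)
    next
      case False
      then obtain j where j: "J = {j}"
        using J by blast
      then have "j < m"
        by (auto simp: J_def)
      then show ?thesis
        using t by (intro exI[of _ "t j"]) (simp add: u_def j)
    qed
    then obtain \<tau> where \<tau>: "\<bar>\<tau>\<bar> \<le> 1" "(\<Sum>j\<in>J. t j *\<^sub>R z j) = \<tau> *\<^sub>R u"
      by blast
    have "A *v s = (\<Sum>i\<in>UNIV. t (\<phi> i) *\<^sub>R g i)"
      unfolding Av by (intro sum.cong refl) (simp add: s_def \<sigma>_def)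
    then have "x = A *v (s + \<tau> *\<^sub>R w) + c"
      using tx \<tau>(2) by (simp add: split matrix_vector_right_distrib matrix_vector_mult_scaleR Aw)
    moreover have "s + \<tau> *\<^sub>R w \<in> cube_plus_segment w"
      using s \<tau>(1) unfolding cube_plus_segment_def by blast
    ultimately show "x \<in> (\<lambda>x. A *v x + c) ` cube_plus_segment w"
      by (rule image_eqI)
  next
    fix x assume "x \<in> (\<lambda>x. A *v x + c) ` cube_plus_segment w"
    then obtain s \<tau> where s: "s \<in> standard_cube" and \<tau>: "\<bar>\<tau>\<bar> \<le> 1" and x: "x = A *v (s + \<tau> *\<^sub>R w) + c"
      unfolding cube_plus_segment_def by blast
    \<comment> \<open>The coefficients of the basis generators are those of \<open>s\<close> up to sign; the leftover one gets \<open>\<tau>\<close>.\<close>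
    define t where "t i = (if i \<in> range \<phi> then \<sigma> (inv \<phi> i) * s $ inv \<phi> i else \<tau>)" for i
    have "\<bar>t i\<bar> \<le> 1" for i
      using s \<tau> by (simp add: t_def mem_standard_cube \<sigma>_def)
    moreover have "(\<Sum>i\<in>UNIV. t (\<phi> i) *\<^sub>R g i) = A *v s"
      unfolding Av using inj by (simp add: t_def)
    moreover have "(\<Sum>j\<in>J. t j *\<^sub>R z j) = \<tau> *\<^sub>R u"
      unfolding u_def scaleR_sum_right by (intro sum.cong refl) (simp add: t_def J_def)
    ultimately have "A *v (s + \<tau> *\<^sub>R w) \<in> (\<Sum>i<m. closed_segment (- z i) (z i))"
      using split[of t] Aw
      by (auto simp: mem_sum_segments matrix_vector_right_distrib matrix_vector_mult_scaleR intro!: exI[of _ t])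
    then show "x \<in> Z"
      unfolding Z x by (auto simp: set_plus_def add.commute)
  qed
  moreover have "0 \<le> w $ i" for i
    by (simp add: w_def)
  ultimately show ?thesis
    using that detA by blast
qed

text \<open>
  Adding a segment parallel to a coordinate axis only stretches the cube along that axis.
\<close>

lemma cube_plus_axis_segment:
  fixes w :: "real^'n"
  assumes w: "\<And>i. 0 \<le> w $ i" and axis: "\<And>j. j \<noteq> k \<Longrightarrow> w $ j = 0"
  obtains E :: "real^'n^'n" where "det E \<noteq> 0" "cube_plus_segment w = (\<lambda>x. E *v x + 0) ` standard_cube"
proof -
  define E :: "real^'n^'n" where "E = (\<chi> i j. if i = j then 1 + w $ i else 0)"
  have Ev: "E *v x = (\<chi> i. (1 + w $ i) * x $ i)" for x
    by (simp add: E_def vec_eq_iff matrix_vector_mult_def if_distribR if_distrib[of "\<lambda>x. x * y" for y] cong: if_cong)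
  have pos: "1 + w $ i > 0" for i
    using w[of i] by simp
  have "det E = (\<Prod>i\<in>UNIV. 1 + w $ i)"
    unfolding E_def by (subst det_diagonal) auto
  then have "det E \<noteq> 0"
    using pos by (simp add: less_imp_neq[symmetric])
  moreover have "cube_plus_segment w = (\<lambda>x. E *v x + 0) ` standard_cube"
  proof (intro subset_antisym subsetI)
    fix x assume "x \<in> cube_plus_segment w"
    then obtain s t where s: "\<And>i. \<bar>s $ i\<bar> \<le> 1" and t: "\<bar>t\<bar> \<le> 1" and x: "x = s + t *\<^sub>R w"
      by (auto simp: cube_plus_segment_def mem_standard_cube)
    define y where "y = (\<chi> i. x $ i / (1 + w $ i))"
    have "\<bar>x $ i\<bar> \<le> 1 + w $ i" for i
    proof -
      have "\<bar>x $ i\<bar> \<le> \<bar>s $ i\<bar> + \<bar>t * w $ i\<bar>"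
        by (simp add: x abs_triangle_ineq)
      also have "\<bar>t * w $ i\<bar> \<le> 1 * w $ i"
        unfolding abs_mult abs_of_nonneg[OF w] using t w by (intro mult_right_mono)
      finally show ?thesis
        using s[of i] by simp
    qed
    then have "y \<in> standard_cube"
      using pos by (simp add: mem_standard_cube y_def abs_divide divide_le_eq less_imp_le)
    moreover have "x = E *v y + 0"
      using pos by (simp add: Ev y_def vec_eq_iff less_imp_neq[symmetric])
    ultimately show "x \<in> (\<lambda>x. E *v x + 0) ` standard_cube"
      by blast
  next
    fix x assume "x \<in> (\<lambda>x. E *v x + 0) ` standard_cube"
    then obtain y where y: "y \<in> standard_cube" and x: "x = E *v y"
      by auto
    have "(1 + w $ i) * y $ i = y $ i + y $ k * w $ i" for i
      using axis by (cases "i = k") (simp_all add: algebra_simps)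
    then have "x = y + y $ k *\<^sub>R w"
      by (simp add: x Ev vec_eq_iff)
    moreover have "\<bar>y $ k\<bar> \<le> 1"
      using y by (simp add: mem_standard_cube)
    ultimately show "x \<in> cube_plus_segment w"
      using y unfolding cube_plus_segment_def by blast
  qed
  ultimately show ?thesis
    using that by blast
qed

lemma affinely_equivalent_iff_det:
  "affinely_equivalent S T \<longleftrightarrow> (\<exists>A b. det A \<noteq> 0 \<and> T = (\<lambda>x. A *v x + b) ` S)"
  by (simp add: affinely_equivalent_def invertible_det_nz)

lemma affinely_equivalent_sym:
  assumes "affinely_equivalent S T"
  shows "affinely_equivalent T S"
proof -
  obtain A b where A: "invertible A" and T: "T = (\<lambda>x. A *v x + b) ` S"
    using assms unfolding affinely_equivalent_def by blast
  obtain B where B: "A ** B = mat 1" "B ** A = mat 1"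
    using A unfolding invertible_def by blast
  have "B *v (A *v x + b) + - (B *v b) = x" for x
    by (simp add: matrix_vector_right_distrib matrix_vector_mul_assoc B)
  then have "S = (\<lambda>x. B *v x + - (B *v b)) ` T"
    unfolding T image_image by simp
  then show ?thesis
    using B unfolding affinely_equivalent_def invertible_def by blast
qed

lemma affinely_equivalent_trans:
  assumes "affinely_equivalent S T" "affinely_equivalent T U"
  shows "affinely_equivalent S U"
proof -
  obtain A b A' b' where "det A \<noteq> 0" "T = (\<lambda>x. A *v x + b) ` S" "det A' \<noteq> 0" "U = (\<lambda>x. A' *v x + b') ` T"
    using assms unfolding affinely_equivalent_iff_det by blast
  then have "det (A' ** A) \<noteq> 0" "U = (\<lambda>x. (A' ** A) *v x + (A' *v b + b')) ` S"
    by (simp_all add: det_mul image_image matrix_vector_right_distrib matrix_vector_mul_assoc add.assoc)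
  then show ?thesis
    unfolding affinely_equivalent_iff_det by blast
qed

lemma measure_cube_plus_segment_pos:
  assumes "\<And>i. 0 \<le> w $ i"
  shows "measure lborel (cube_plus_segment w) > 0"
  using cube_plus_segment_moments(1)[OF assms] assms by (simp add: add_pos_nonneg sum_nonneg)


section \<open>Maximality of the cube\<close>

theorem proposition6p1:
  fixes Z :: "(real ^ 'n) set" and m :: nat
  assumes "zonotope_with_generators m Z"
    and "m \<le> CARD('n) + 1"
    and "interior Z \<noteq> {}"
  shows "isotropic_constant Z \<le> isotropic_constant (standard_cube :: (real ^ 'n) set) \<and>
    (isotropic_constant Z = isotropic_constant (standard_cube :: (real ^ 'n) set) \<longleftrightarrow>
      affinely_equivalent Z standard_cube)"
proof -
  let ?C = "standard_cube :: (real^'n) set"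
  obtain A :: "real^'n^'n" and c w where A: "det A \<noteq> 0" and w: "\<And>i. 0 \<le> w $ i"
    and Z: "Z = (\<lambda>x. A *v x + c) ` cube_plus_segment w"
    by (rule zonotope_normal_form[OF assms]) (rule that)
  define \<kappa> where "\<kappa> = (1/3) ^ CARD('n) / (4 ^ CARD('n) :: real)"
  have \<kappa>: "\<kappa> > 0"
    by (simp add: \<kappa>_def)
  have LZ: "isotropic_constant Z = root (2 * CARD('n)) (\<kappa> * det_ratio w)"
    unfolding Z isotropic_constant_affine_image[OF A compact_cube_plus_segment measure_cube_plus_segment_pos[OF w]]
    unfolding \<kappa>_def by (rule isotropic_constant_cube_plus_segment[OF w])
  have "det_ratio (0 :: real^'n) = 1"
    by (simp add: det_ratio_def)
  then have LC: "isotropic_constant ?C = root (2 * CARD('n)) \<kappa>"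
    using isotropic_constant_cube_plus_segment[of "0 :: real^'n"]
    by (simp add: standard_cube_eq_cube_plus_segment \<kappa>_def)
  have "isotropic_constant Z \<le> isotropic_constant ?C"
    unfolding LZ LC using det_ratio_le_1(1)[OF w] \<kappa> by simp
  moreover have "affinely_equivalent Z ?C" if eq: "isotropic_constant Z = isotropic_constant ?C"
  proof -
    have "det_ratio w = 1"
      using eq \<kappa> unfolding LZ LC by simp
    then have "w $ i = 0 \<or> w $ j = 0" if "i \<noteq> j" for i j
      using det_ratio_le_1(2)[OF w that] w by (metis less_le order_less_irrefl)
    then obtain k where "\<And>j. j \<noteq> k \<Longrightarrow> w $ j = 0"
      by metis
    then have "affinely_equivalent ?C (cube_plus_segment w)"
      using cube_plus_axis_segment[OF w] unfolding affinely_equivalent_iff_det by metis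
    moreover have "affinely_equivalent (cube_plus_segment w) Z"
      using A Z unfolding affinely_equivalent_iff_det by blast
    ultimately show ?thesis
      using affinely_equivalent_sym affinely_equivalent_trans by blast
  qed
  moreover have "isotropic_constant Z = isotropic_constant ?C" if "affinely_equivalent Z ?C"
  proof -
    obtain B b where B: "det B \<noteq> 0" and C: "?C = (\<lambda>x. B *v x + b) ` Z"
      using \<open>affinely_equivalent Z ?C\<close> unfolding affinely_equivalent_iff_det by blast
    have "compact Z"
      unfolding Z by (intro compact_affine_image compact_cube_plus_segment)
    moreover have "measure lborel Z > 0"
      unfolding Z measure_affine_image[OF A compact_cube_plus_segment]
      using A measure_cube_plus_segment_pos[OF w] by simp
    ultimately show ?thesis
      unfolding C using isotropic_constant_affine_image[OF B] by simp
  qed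
  ultimately show ?thesis
    by blast
qed

end
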